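(* Let $\mathcal P$ be a pre-Hahn-localizable family of probability measures on $(\Omega,\mathcal F)$ with a localization $\mathcal Q$ with pairwise disjoint supports, and let $\mathcal H_0,\mathcal H_1$ be families of probability measures on $\mathcal F$ with $\mathcal H_0\lll\mathcal P$ and $\mathcal H_1\lll\mathcal P$. Then for every $\varepsilon>0$ the following are equivalent: (i) there is a test $\phi\in\mathbb L^\infty(\mathcal H_{\mathcal F}^{\mathcal Q},\mathcal P^{\mathcal Q})$, i.e. $0\le\phi\le1$ $\mathcal P$-q.s., with $\inf_{\nu\in\mathcal H_1}\int\phi\,d\nu^{\mathcal Q}>\sup_{\mu\in\mathcal H_0}\int\phi\,d\mu^{\mathcal Q}+\varepsilon$; (ii) $d_{TV}(\mathrm{co}(\mathcal H_0),\mathrm{co}(\mathcal H_1))>\varepsilon$.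
   Context: $\mathcal P\lll\mathcal Q$ means each $P\in\mathcal P$ is absolutely continuous w.r.t. some $Q\in\mathcal Q$; $\mathrm{sconv}$ denotes countable convex combinations, $\mathrm{co}$ the convex hull. $\mathcal P$ is pre-Hahn-localizable with localization $\mathcal Q$ and supports $S_Q\in\mathcal F$ if $Q(S_R)=\delta_{QR}$ for $Q,R\in\mathcal Q$ and $\mathcal Q\lll\mathcal P\lll\mathrm{sconv}(\mathcal Q)$. Hahn-extension: $\mathcal H_{\mathcal F}^{\mathcal Q}=\sigma\big(\mathcal F\cup\{\bigcup_{Q\in\mathcal Q}E_Q:E_Q\in\mathcal F,E_Q\subseteq S_Q\}\big)$. For a finite signed measure $\mu$ on $\mathcal F$ absolutely continuous (in total variation) w.r.t. some element of $\mathcal P$, set $\mathcal Q(\mu)=\{Q:|\mu|(S_Q)>0\}$ (countable) and $\mu^{\mathcal Q}(A)=\sum_{Q\in\mathcal Q(\mu)}\mu(A\cap S_Q)$, $A\in\mathcal H_{\mathcal F}^{\mathcal Q}$, the canonical extension; $\mathcal P^{\mathcal Q}=\{P^{\mathcal Q}:P\in\mathcal P\}$. $\mathbb L^\infty(\mathcal H_{\mathcal F}^{\mathcal Q},\mathcal P^{\mathcal Q})$ is the space of $\mathcal H_{\mathcal F}^{\mathcal Q}$-measurable functions bounded outside a set null for all $P^{\mathcal Q}$, modulo equality outside such a set. For sets $A,B$ of probability measures, $d_{TV}(A,B)=\inf_{\mu\in A,\nu\in B}\frac12\|\mu-\nu\|_{TV}$. *)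

theory Defs
  imports "HOL-Probability.Probability"
begin

text \<open>The underlying measurable space (Omega, F) is represented by a measure M;
  only space M and sets M are used.\<close>

definition prob_family :: "'a measure \<Rightarrow> 'a measure set \<Rightarrow> bool" where
  "prob_family M H \<longleftrightarrow> (\<forall>N\<in>H. prob_space N \<and> sets N = sets M)"

text \<open>P lll Q: every element of P is absolutely continuous w.r.t. some element of Q.
  (absolutely_continuous R P means P << R.)\<close>
definition dominated_by :: "'a measure set \<Rightarrow> 'a measure set \<Rightarrow> bool" where
  "dominated_by P Q \<longleftrightarrow> (\<forall>p\<in>P. \<exists>q\<in>Q. absolutely_continuous q p)"

definition sconv :: "'a measure \<Rightarrow> 'a measure set \<Rightarrow> 'a measure set" where
  "sconv M Q = {N. sets N = sets M \<and>
     (\<exists>q :: nat \<Rightarrow> 'a measure. \<exists>c :: nat \<Rightarrow> real.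
        (\<forall>i. q i \<in> Q) \<and> (\<forall>i. 0 \<le> c i) \<and> c sums 1 \<and>
        (\<forall>A\<in>sets M. emeasure N A = (\<Sum>i. ennreal (c i) * emeasure (q i) A)))}"

definition co :: "'a measure \<Rightarrow> 'a measure set \<Rightarrow> 'a measure set" where
  "co M H = {N. sets N = sets M \<and>
     (\<exists>n. \<exists>q :: nat \<Rightarrow> 'a measure. \<exists>c :: nat \<Rightarrow> real.
        (\<forall>i<n. q i \<in> H) \<and> (\<forall>i<n. 0 \<le> c i) \<and> (\<Sum>i<n. c i) = 1 \<and>
        (\<forall>A\<in>sets M. emeasure N A = (\<Sum>i<n. ennreal (c i) * emeasure (q i) A)))}"

definition pre_hahn_localizable ::
  "'a measure \<Rightarrow> 'a measure set \<Rightarrow> 'a measure set \<Rightarrow> ('a measure \<Rightarrow> 'a set) \<Rightarrow> bool" where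
  "pre_hahn_localizable M P Q S \<longleftrightarrow>
     prob_family M P \<and> prob_family M Q \<and>
     (\<forall>q\<in>Q. S q \<in> sets M) \<and>
     (\<forall>q\<in>Q. \<forall>r\<in>Q. emeasure q (S r) = (if q = r then 1 else 0)) \<and>
     dominated_by Q P \<and> dominated_by P (sconv M Q)"

definition hahn_gen :: "'a measure \<Rightarrow> 'a measure set \<Rightarrow> ('a measure \<Rightarrow> 'a set) \<Rightarrow> 'a set set" where
  "hahn_gen M Q S = sets M \<union>
     {(\<Union>q\<in>Q. E q) | E. \<forall>q\<in>Q. E q \<in> sets M \<and> E q \<subseteq> S q}"

definition hahn_ext :: "'a measure \<Rightarrow> 'a measure set \<Rightarrow> ('a measure \<Rightarrow> 'a set) \<Rightarrow> 'a measure" where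
  "hahn_ext M Q S = sigma (space M) (hahn_gen M Q S)"

text \<open>Q(mu) for a (positive) measure mu: |mu| = mu.\<close>
definition Qof :: "'a measure set \<Rightarrow> ('a measure \<Rightarrow> 'a set) \<Rightarrow> 'a measure \<Rightarrow> 'a measure set" where
  "Qof Q S \<mu> = {q\<in>Q. emeasure \<mu> (S q) > 0}"

definition can_ext :: "'a measure \<Rightarrow> 'a measure set \<Rightarrow> ('a measure \<Rightarrow> 'a set) \<Rightarrow> 'a measure \<Rightarrow> 'a measure" where
  "can_ext M Q S \<mu> = measure_of (space M) (sets (hahn_ext M Q S))
     (\<lambda>A. \<integral>\<^sup>+ q. emeasure \<mu> (A \<inter> S q) \<partial>count_space (Qof Q S \<mu>))"

definition tv_norm :: "'a measure \<Rightarrow> 'a measure \<Rightarrow> real" where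
  "tv_norm \<mu> \<nu> = Sup {(\<Sum>A\<in>\<A>. \<bar>measure \<mu> A - measure \<nu> A\<bar>) | \<A>.
      finite \<A> \<and> \<A> \<subseteq> sets \<mu> \<and> disjoint \<A> \<and> \<Union>\<A> = space \<mu>}"

definition d_TV :: "'a measure set \<Rightarrow> 'a measure set \<Rightarrow> ereal" where
  "d_TV A B = (INF p\<in>A \<times> B. ereal (tv_norm (fst p) (snd p) / 2))"

definition is_test :: "'a measure \<Rightarrow> 'a measure set \<Rightarrow> 'a measure set \<Rightarrow> ('a measure \<Rightarrow> 'a set)
     \<Rightarrow> ('a \<Rightarrow> real) \<Rightarrow> bool" where
  "is_test M P Q S \<phi> \<longleftrightarrow> \<phi> \<in> borel_measurable (hahn_ext M Q S) \<and>
     (\<exists>N\<in>sets (hahn_ext M Q S). (\<forall>p\<in>P. emeasure (can_ext M Q S p) N = 0) \<and>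
        (\<forall>\<omega>\<in>space M - N. 0 \<le> \<phi> \<omega> \<and> \<phi> \<omega> \<le> 1))"

end

theory Submission
  imports Defs
begin

text \<open>
  A test with gap more than \<open>\<epsilon>\<close> becomes \<open>F\<close>-measurable after restriction to the countably many supports
  charged by finitely many hypotheses, and then bounds the total variation distance of convex
  combinations from below.

  For the converse, view tests as functionals \<open>\<mu> \<mapsto> \<integral> \<phi> d\<mu>\<close> on finite measures. The set of all additive,
  homogeneous functionals \<open>L\<close> with \<open>0 \<le> L \<mu> \<le> \<mu>(\<Omega>)\<close> is convex, and compact for pointwise convergence by
  Tychonoff's theorem. A minimax argument yields such an \<open>L\<close> with \<open>L \<mu> + \<alpha> \<le> L \<nu>\<close> for all hypotheses
  \<open>\<mu>\<close>, \<open>\<nu>\<close> and some \<open>\<alpha> > \<epsilon>\<close>.  By Radon-Nikodym, \<open>L\<close> is represented by a density \<open>f\<^sub>q\<close> on the measures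
  absolutely continuous with respect to a given \<open>q \<in> Q\<close>, and gluing the \<open>f\<^sub>q\<close> along the disjoint supports
  gives a test that is measurable for the Hahn extension.
\<close>

section \<open>Minimax for concave-like families\<close>

text \<open>The hypotheses need not share a dominating measure, so tests cannot be taken from the
  dual of a single L1 space, and the original sigma-algebra may be too small to hold a limit of
  tests. Functionals on measures avoid both problems, since their compactness refers to no base
  measure. Such a limit is a priori only finitely additive. The bound by the total mass restores
  countable additivity along the densities of each fixed finite measure, and this is what lets
  Radon-Nikodym apply. In this direction the localization is used only afterwards, to turn a
  functional into one function: each support has its own density, and each hypothesis is carried by
  countably many supports, so the exceptional null sets can be united. The constant \<alpha> lies
  strictly between \<epsilon> and the distance. Compactness preserves only closed constraints, hence
  \<open>L \<mu> + \<alpha> \<le> L \<nu>\<close> is non-strict, and the surplus of \<alpha> over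
  \<epsilon> makes the final inequality of infimum and supremum strict.\<close>

lemma two_function_minimax:
  fixes f g :: "'b::topological_space \<Rightarrow> real"
  assumes K: "compact K" and f: "continuous_on K f" and g: "continuous_on K g"
    and conv: "\<And>x y t. x \<in> K \<Longrightarrow> y \<in> K \<Longrightarrow> 0 \<le> t \<Longrightarrow> t \<le> 1 \<Longrightarrow>
      \<exists>z\<in>K. f z = (1 - t) * f x + t * f y \<and> g z = (1 - t) * g x + t * g y"
    and less: "\<And>x. x \<in> K \<Longrightarrow> f x < \<alpha> \<or> g x < \<alpha>"
  shows "\<exists>t. 0 \<le> t \<and> t \<le> 1 \<and> (\<forall>x\<in>K. (1 - t) * f x + t * g x < \<alpha>)"
proof (cases "K = {}")
  case True
  then show ?thesis by (auto intro: exI[of _ 0])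
next
  case False
  \<comment> \<open>The image of \<open>K\<close> in the plane is compact and, by
    \<open>conv\<close>, convex; by \<open>less\<close> it misses the closed quadrant
    \<open>B\<close> with corner (\<alpha>, \<alpha>). The normal of a separating line, scaled to
    coordinate sum 1, gives the two weights, and comparison with the corner gives the bound
    \<alpha>.\<close>
  define A where "A = (\<lambda>x. (f x, g x)) ` K"
  define B where "B = {\<alpha>..} \<times> {\<alpha>..}"
  have "compact A"
    unfolding A_def by (intro compact_continuous_image continuous_on_Pair f g K)
  moreover have "convex A"
  proof (unfold convex_alt A_def, safe)
    fix x y and t :: real assume "x \<in> K" "y \<in> K" "0 \<le> t" "t \<le> 1"
    then obtain z where "z \<in> K" "f z = (1 - t) * f x + t * f y" "g z = (1 - t) * g x + t * g y"
      using conv by blast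
    then show "(1 - t) *\<^sub>R (f x, g x) + t *\<^sub>R (f y, g y) \<in> (\<lambda>x. (f x, g x)) ` K"
      by (intro image_eqI[of _ _ z]) auto
  qed
  moreover have "convex B" "closed B"
    unfolding B_def by (auto intro!: convex_Times closed_Times)
  moreover have "A \<inter> B = {}" "A \<noteq> {}"
    using less False by (fastforce simp: A_def B_def)+
  ultimately obtain a b where ab: "\<And>p. p \<in> A \<Longrightarrow> inner a p < b" "\<And>p. p \<in> B \<Longrightarrow> inner a p > b"
    using separating_hyperplane_compact_closed[of A B] by blast
  obtain u v where a: "a = (u, v)" by fastforce
  have B: "b < u * x + v * y" if "\<alpha> \<le> x" "\<alpha> \<le> y" for x y
    using ab(2)[of "(x, y)"] that by (simp add: a B_def)
  have A: "u * f x + v * g x < b" if "x \<in> K" for x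
    using ab(1)[of "(f x, g x)"] that by (auto simp: a A_def)
  \<comment> \<open>The quadrant is unbounded in both coordinate directions, so a linear form
    bounded below on it has no negative coefficient. For negative \<open>w\<close> the point used
    makes \<open>w * s\<close> equal to \<open>- \<bar>c\<bar>\<close>, which is not above
    \<open>c\<close>.\<close>
  have nonneg: "0 \<le> w" if "\<And>s. 0 \<le> s \<Longrightarrow> c < w * s" for w c :: real
  proof (rule ccontr)
    assume "\<not> 0 \<le> w"
    then have "w * (\<bar>c\<bar> / - w) = - \<bar>c\<bar>" "0 \<le> \<bar>c\<bar> / - w"
      by (auto simp: field_simps)
    with that[of "\<bar>c\<bar> / - w"] have "c < - \<bar>c\<bar>" by metis
    then show False by linarith
  qed
  have u: "0 \<le> u"
    by (rule nonneg[of "b - u * \<alpha> - v * \<alpha>"]) (use B[of "\<alpha> + _" \<alpha>] in \<open>simp add: algebra_simps\<close>)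
  have v: "0 \<le> v"
    by (rule nonneg[of "b - u * \<alpha> - v * \<alpha>"]) (use B[of \<alpha> "\<alpha> + _"] in \<open>simp add: algebra_simps\<close>)
  have "u + v \<noteq> 0"
  proof
    assume "u + v = 0"
    with u v have "u = 0" "v = 0" by auto
    with B[of \<alpha> \<alpha>] A False show False by force
  qed
  with u v have uv: "0 < u + v" by auto
  have 1: "1 - v / (u + v) = u / (u + v)"
    using uv by (simp add: field_simps)
  have "(1 - v / (u + v)) * f x + v / (u + v) * g x < \<alpha>" if "x \<in> K" for x
  proof -
    have "u * f x + v * g x < \<alpha> * (u + v)"
      using A[OF that] B[of \<alpha> \<alpha>] by (simp add: algebra_simps)
    then show ?thesis
      unfolding 1 using uv by (simp add: divide_simps)
  qed
  with u v uv show ?thesis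
    by (intro exI[of _ "v / (u + v)"]) (auto simp: divide_simps)
qed

text \<open>In the inductive step the induction hypothesis is applied to the part of \<open>K\<close> where the new function is
  at least \<open>\<alpha>\<close>; this is why convexity is only required of the family of functions, and \<open>K\<close> needs no
  linear structure.\<close>

lemma finite_minimax:
  fixes f :: "'i \<Rightarrow> 'b::topological_space \<Rightarrow> real"
  assumes "finite I" "I \<noteq> {}" "compact K"
    and "\<And>i. i \<in> I \<Longrightarrow> continuous_on UNIV (f i)"
    and "\<And>x y t. x \<in> K \<Longrightarrow> y \<in> K \<Longrightarrow> 0 \<le> t \<Longrightarrow> t \<le> 1 \<Longrightarrow>
      \<exists>z\<in>K. \<forall>i\<in>I. f i z = (1 - t) * f i x + t * f i y"
    and "\<And>x. x \<in> K \<Longrightarrow> \<exists>i\<in>I. f i x < \<alpha>"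
  shows "\<exists>w. (\<forall>i. 0 \<le> w i) \<and> sum w I = 1 \<and> (\<forall>x\<in>K. (\<Sum>i\<in>I. w i * f i x) < \<alpha>)"
  using assms
proof (induction I arbitrary: K rule: finite_ne_induct)
  case (singleton i)
  then show ?case by (intro exI[of _ "\<lambda>_. 1"]) auto
next
  case (insert i I)
  define K' where "K' = K \<inter> {x. \<alpha> \<le> f i x}"
  have "compact K'"
    unfolding K'_def using insert.prems
    by (intro compact_Int_closed closed_Collect_le continuous_on_const) auto
  moreover have "\<exists>z\<in>K'. \<forall>j\<in>I. f j z = (1 - t) * f j x + t * f j y"
    if xy: "x \<in> K'" "y \<in> K'" "0 \<le> t" "t \<le> 1" for x y t
  proof -
    have "\<alpha> \<le> (1 - t) * f i x + t * f i y"
      using that convex_bound_le[of "- f i x" "- \<alpha>" "- f i y" "1 - t" t]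
      by (auto simp: K'_def)
    moreover obtain z where "z \<in> K" "\<forall>j\<in>insert i I. f j z = (1 - t) * f j x + t * f j y"
      using insert.prems(3)[of x y t] xy unfolding K'_def by blast
    ultimately show ?thesis
      by (intro bexI[of _ z]) (auto simp: K'_def)
  qed
  moreover have "\<exists>j\<in>I. f j x < \<alpha>" if "x \<in> K'" for x
    using insert.prems(4)[of x] that by (auto simp: K'_def)
  ultimately have "\<exists>w. (\<forall>j. 0 \<le> w j) \<and> sum w I = 1 \<and> (\<forall>x\<in>K'. (\<Sum>j\<in>I. w j * f j x) < \<alpha>)"
    using insert.prems(2) by (intro insert.IH) simp_all
  then obtain w where w: "\<And>j. 0 \<le> w j" "sum w I = 1"
      "\<And>x. x \<in> K' \<Longrightarrow> (\<Sum>j\<in>I. w j * f j x) < \<alpha>"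
    by blast
  define g where "g x = (\<Sum>j\<in>I. w j * f j x)" for x
  \<comment> \<open>On \<open>K'\<close> the combination \<open>g\<close> is below \<alpha> by the
    induction hypothesis, and off \<open>K'\<close> the function \<open>f i\<close> is. The
    two-function case therefore merges \<open>g\<close> and \<open>f i\<close> on all of
    \<open>K\<close>.\<close>
  have "\<exists>t. 0 \<le> t \<and> t \<le> 1 \<and> (\<forall>x\<in>K. (1 - t) * g x + t * f i x < \<alpha>)"
  proof (rule two_function_minimax)
    show "continuous_on K g" "continuous_on K (f i)"
      unfolding g_def using insert.prems(2)
      by (auto intro!: continuous_intros intro: continuous_on_subset)
    show "\<exists>z\<in>K. g z = (1 - t) * g x + t * g y \<and> f i z = (1 - t) * f i x + t * f i y"
      if xy: "x \<in> K" "y \<in> K" "0 \<le> t" "t \<le> 1" for x y t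
    proof -
      obtain z where "z \<in> K" and z: "\<forall>j\<in>insert i I. f j z = (1 - t) * f j x + t * f j y"
        using insert.prems(3)[OF xy] by blast
      have "g z = (\<Sum>j\<in>I. w j * ((1 - t) * f j x + t * f j y))"
        unfolding g_def using z by (intro sum.cong) auto
      also have "\<dots> = (1 - t) * g x + t * g y"
        by (simp add: g_def sum_distrib_left algebra_simps sum.distrib sum_subtractf)
      finally show ?thesis using \<open>z \<in> K\<close> z by auto
    qed
    show "g x < \<alpha> \<or> f i x < \<alpha>" if "x \<in> K" for x
      using w(3)[of x] that by (auto simp: K'_def g_def not_less)
  qed (fact insert.prems(1))
  then obtain t where t: "0 \<le> t" "t \<le> 1" "\<And>x. x \<in> K \<Longrightarrow> (1 - t) * g x + t * f i x < \<alpha>"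
    by blast
  define w' where "w' j = (if j = i then t else (1 - t) * w j)" for j
  have w': "(\<Sum>j\<in>I. w' j * h j) = (1 - t) * (\<Sum>j\<in>I. w j * h j)" for h :: "'i \<Rightarrow> real"
    unfolding sum_distrib_left using insert.hyps by (intro sum.cong) (auto simp: w'_def)
  have "\<forall>j. 0 \<le> w' j"
    using t w(1) by (auto simp: w'_def)
  moreover have "sum w' (insert i I) = 1"
    using w'[of "\<lambda>_. 1"] w(2) insert.hyps by (simp add: w'_def)
  moreover have "(\<Sum>j\<in>insert i I. w' j * f j x) < \<alpha>" if "x \<in> K" for x
    using t(3)[OF that] w'[of "\<lambda>j. f j x"] insert.hyps by (simp add: w'_def g_def add.commute)
  ultimately show ?case by blast
qed

section \<open>Test functionals\<close>

text \<open>Abstract limits of the functionals \<open>\<mu> \<mapsto> \<integral> \<phi> d\<mu>\<close> for tests \<open>\<phi>\<close>.  There is no addition on the type of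
  measures, so linearity is expressed through densities with respect to a common base measure.\<close>

definition test_functionals :: "'a measure \<Rightarrow> ('a measure \<Rightarrow> real) set" where
  "test_functionals M = {L. (\<forall>N. L N \<in> {0..measure N (space N)}) \<and>
     (\<forall>N g h. finite_measure N \<longrightarrow> sets N = sets M \<longrightarrow>
        g \<in> borel_measurable M \<longrightarrow> h \<in> borel_measurable M \<longrightarrow>
        (\<integral>\<^sup>+x. g x \<partial>N) < \<infinity> \<longrightarrow> (\<integral>\<^sup>+x. h x \<partial>N) < \<infinity> \<longrightarrow>
        L (density N (\<lambda>x. g x + h x)) = L (density N g) + L (density N h)) \<and>
     (\<forall>N g c. finite_measure N \<longrightarrow> sets N = sets M \<longrightarrow>
        g \<in> borel_measurable M \<longrightarrow> (\<integral>\<^sup>+x. g x \<partial>N) < \<infinity> \<longrightarrow> 0 \<le> c \<longrightarrow>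
        L (density N (\<lambda>x. ennreal c * g x)) = c * L (density N g))}"

text \<open>The bound by the total mass holds at every value of the type, so the set lies in a
  product of compact intervals, one for each measure. Every other clause equates expressions in
  finitely many coordinates and is therefore closed for pointwise convergence.\<close>

lemma compact_test_functionals: "compact (test_functionals M)"
proof -
  have "compact (PiE UNIV (\<lambda>N :: 'a measure. {0..measure N (space N)}))"
    using compactin_PiE[of "\<lambda>_. euclideanreal" UNIV "\<lambda>N :: 'a measure. {0..measure N (space N)}"]
    by (simp add: euclidean_product_topology)
  then show ?thesis
    unfolding test_functionals_def Collect_conj_eq PiE_UNIV_domain Pi_def
    by (intro compact_Int_closed closed_Int closed_Collect_all closed_Collect_imp
        open_Collect_const closed_Collect_eq continuous_intros) (auto simp: Pi_def)
qed

lemma convex_combination_test_functionals: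
  assumes "L \<in> test_functionals M" "L' \<in> test_functionals M" "0 \<le> t" "t \<le> 1"
  shows "(\<lambda>N. (1 - t) * L N + t * L' N) \<in> test_functionals M"
proof -
  have "0 \<le> L N" "L N \<le> measure N (space N)" "0 \<le> L' N" "L' N \<le> measure N (space N)" for N
    using assms by (auto simp: test_functionals_def)
  then have "0 \<le> (1 - t) * L N + t * L' N \<and> (1 - t) * L N + t * L' N \<le> measure N (space N)" for N
    using assms(3,4) by (auto intro!: convex_bound_le)
  then show ?thesis
    using assms unfolding test_functionals_def
    by (simp add: algebra_simps)
qed

text \<open>This is how the Hahn set of two mixtures enters the minimax argument. For an infinite
  \<open>N\<close> the value 0 is forced, because \<open>measure N (space N)\<close> is then 0 while
  \<open>Y\<close> may have positive finite measure. By \<open>fin\<close>, the densities in the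
  linearity clauses are finite measures, so the case distinction does not disturb
  additivity.\<close>

lemma set_in_test_functionals:
  assumes Y: "Y \<in> sets M"
  shows "(\<lambda>N. if finite_measure N \<and> sets N = sets M then measure N Y else 0) \<in> test_functionals M"
    (is "?L \<in> _")
proof -
  have fin: "finite_measure (density N g)"
    if "sets N = sets M" "g \<in> borel_measurable M" "(\<integral>\<^sup>+x. g x \<partial>N) < \<infinity>" for N :: "'a measure" and g
  proof (rule finite_measureI)
    have "g \<in> borel_measurable N" using that measurable_cong_sets by blast
    then have "emeasure (density N g) (space N) = (\<integral>\<^sup>+x. g x \<partial>N)"
      by (auto simp: emeasure_density intro!: nn_integral_cong)
    then show "emeasure (density N g) (space (density N g)) \<noteq> \<infinity>"
      using that(3) by simp
  qed
  have density: "?L (density N g) = enn2real (\<integral>\<^sup>+x. g x * indicator Y x \<partial>N)"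
    if "finite_measure N" "sets N = sets M" "g \<in> borel_measurable M" "(\<integral>\<^sup>+x. g x \<partial>N) < \<infinity>" for N g
  proof -
    have "g \<in> borel_measurable N" using that measurable_cong_sets by blast
    then show ?thesis
      using that Y fin[of N g] by (simp add: emeasure_density measure_def)
  qed
  have below: "(\<integral>\<^sup>+x. g x * indicator Y x \<partial>N) < \<infinity>" if "(\<integral>\<^sup>+x. g x \<partial>N) < \<infinity>" for N :: "'a measure" and g
    using that by (rule order.strict_trans1[rotated]) (auto intro!: nn_integral_mono simp: indicator_def)
  show ?thesis
    unfolding test_functionals_def mem_Collect_eq
  proof (intro conjI allI impI)
    show "?L N \<in> {0..measure N (space N)}" for N
      using finite_measure.finite_measure_mono[of N Y "space N"] sets.sets_into_space[of Y N] Y by auto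
  next
    fix N and g h :: "'a \<Rightarrow> ennreal"
    assume N: "finite_measure N" "sets N = sets M" and g: "g \<in> borel_measurable M" "h \<in> borel_measurable M"
      and f: "(\<integral>\<^sup>+x. g x \<partial>N) < \<infinity>" "(\<integral>\<^sup>+x. h x \<partial>N) < \<infinity>"
    have m[measurable]: "g \<in> borel_measurable N" "h \<in> borel_measurable N" "Y \<in> sets N"
      using N g Y measurable_cong_sets by blast+
    have "(\<integral>\<^sup>+x. g x + h x \<partial>N) < \<infinity>"
      using f by (simp add: nn_integral_add)
    then show "?L (density N (\<lambda>x. g x + h x)) = ?L (density N g) + ?L (density N h)"
      using N g f below[OF f(1)] below[OF f(2)]
      by (subst (1 2 3) density) (auto simp: distrib_right nn_integral_add intro!: enn2real_plus)
  next
    fix N and g :: "'a \<Rightarrow> ennreal" and c :: real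
    assume N: "finite_measure N" "sets N = sets M" and g: "g \<in> borel_measurable M"
      and f: "(\<integral>\<^sup>+x. g x \<partial>N) < \<infinity>" and c: "0 \<le> c"
    have m[measurable]: "g \<in> borel_measurable N" "Y \<in> sets N"
      using N g Y measurable_cong_sets by blast+
    have "(\<integral>\<^sup>+x. ennreal c * g x \<partial>N) < \<infinity>"
      using f by (simp add: nn_integral_cmult ennreal_mult_less_top)
    then show "?L (density N (\<lambda>x. ennreal c * g x)) = c * ?L (density N g)"
      using N g f c
      by (subst (1 2) density) (auto simp: mult.assoc nn_integral_cmult enn2real_mult)
  qed
qed

lemma test_functionals_cong: "sets M = sets N \<Longrightarrow> test_functionals M = test_functionals N"
  by (simp add: test_functionals_def cong: measurable_cong_sets)

section \<open>Radon-Nikodym densities of test functionals\<close>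

context finite_measure
begin

lemma test_functional_le:
  assumes L: "L \<in> test_functionals M" and g: "g \<in> borel_measurable M" "(\<integral>\<^sup>+x. g x \<partial>M) < \<infinity>"
  shows "0 \<le> L (density M g)" "ennreal (L (density M g)) \<le> (\<integral>\<^sup>+x. g x \<partial>M)"
proof -
  have *: "0 \<le> L (density M g)" "L (density M g) \<le> measure (density M g) (space M)"
    using L by (auto simp: test_functionals_def dest: spec[of _ "density M g"])
  show "0 \<le> L (density M g)" by fact
  have e: "emeasure (density M g) (space M) = (\<integral>\<^sup>+x. g x \<partial>M)"
    using g by (auto simp: emeasure_density intro!: nn_integral_cong)
  have "ennreal (L (density M g)) \<le> ennreal (measure (density M g) (space M))"
    using * by (intro ennreal_leI)
  also have "\<dots> = (\<integral>\<^sup>+x. g x \<partial>M)"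
    using e g(2) by (simp add: measure_def)
  finally show "ennreal (L (density M g)) \<le> (\<integral>\<^sup>+x. g x \<partial>M)" .
qed

lemma test_functional_add:
  assumes L: "L \<in> test_functionals M"
    and g: "g \<in> borel_measurable M" "(\<integral>\<^sup>+x. g x \<partial>M) < \<infinity>"
    and h: "h \<in> borel_measurable M" "(\<integral>\<^sup>+x. h x \<partial>M) < \<infinity>"
  shows "L (density M (\<lambda>x. g x + h x)) = L (density M g) + L (density M h)"
  using assms finite_measure_axioms unfolding test_functionals_def by blast

lemma test_functional_cmult:
  assumes "L \<in> test_functionals M" "g \<in> borel_measurable M" "(\<integral>\<^sup>+x. g x \<partial>M) < \<infinity>" "0 \<le> c"
  shows "L (density M (\<lambda>x. ennreal c * g x)) = c * L (density M g)"
  using assms finite_measure_axioms unfolding test_functionals_def by blast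

text \<open>The excess \<open>f - 1\<close> is integrated over the set \<open>B\<close> where it is
  positive. The result is the mass of \<open>B\<close> under the density minus its mass under
  \<open>M\<close>, which truncated subtraction makes 0; finiteness of \<open>M\<close> justifies
  splitting the integral.\<close>

lemma AE_density_le_1:
  assumes f[measurable]: "f \<in> borel_measurable M"
    and le: "\<And>A. A \<in> sets M \<Longrightarrow> emeasure (density M f) A \<le> emeasure M A"
  shows "AE x in M. f x \<le> 1"
proof -
  define B where "B = {x \<in> space M. 1 < f x}"
  have B[measurable]: "B \<in> sets M" unfolding B_def by measurable
  have "(\<integral>\<^sup>+x. (f x - 1) * indicator B x \<partial>M) = (\<integral>\<^sup>+x. f x * indicator B x - indicator B x \<partial>M)"
    by (intro nn_integral_cong) (auto simp: indicator_def)
  also have "\<dots> = (\<integral>\<^sup>+x. f x * indicator B x \<partial>M) - emeasure M B"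
    by (subst nn_integral_diff) (auto simp: indicator_def B_def less_imp_le)
  also have "\<dots> = 0"
    using le[OF B] emeasure_finite[of B]
    by (auto simp: emeasure_density diff_eq_0_iff_ennreal less_top[symmetric] dest: neq_top_trans[rotated])
  finally have "AE x in M. (f x - 1) * indicator B x = 0"
    by (subst (asm) nn_integral_0_iff_AE) auto
  with AE_space show ?thesis
    by eventually_elim (auto simp: B_def indicator_def diff_eq_0_iff_ennreal split: if_splits)
qed

text \<open>Domination of \<open>l\<close> by \<open>M\<close> does all the analytic work: with
  finite additivity it gives continuity at the empty set and hence a measure, then absolute
  continuity, and finally a density of at most 1.\<close>

lemma test_functional_representation_indicator:
  assumes L: "L \<in> test_functionals M"
  shows "\<exists>f\<in>borel_measurable M. (\<forall>x. 0 \<le> f x \<and> f x \<le> (1::real)) \<and>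
    (\<forall>A\<in>sets M. ennreal (L (density M (indicator A))) = (\<integral>\<^sup>+x. ennreal (f x) * indicator A x \<partial>M))"
proof -
  define l where "l A = ennreal (L (density M (indicator A)))" for A
  have ind: "(indicator A :: 'a \<Rightarrow> ennreal) \<in> borel_measurable M" "(\<integral>\<^sup>+x. indicator A x \<partial>M) < \<infinity>"
    if "A \<in> sets M" for A
    using that by (auto simp: less_top[symmetric])
  have l_le: "l A \<le> emeasure M A" if "A \<in> sets M" for A
    using test_functional_le(2)[OF L ind[OF that]] that by (simp add: l_def)
  have "positive (sets M) l"
    using l_le[of "{}"] by (simp add: positive_def)
  moreover have "countably_additive (sets M) l"
  proof (rule sets.empty_continuous_imp_countably_additive)
    show "additive (sets M) l"
    proof (unfold additive_def, intro ballI impI)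
      fix A B assume AB: "A \<in> sets M" "B \<in> sets M" "A \<inter> B = {}"
      then have "density M (indicator (A \<union> B)) = density M (\<lambda>x. indicator A x + indicator B x)"
        by (intro density_cong) (auto simp: indicator_def)
      then show "l (A \<union> B) = l A + l B"
        using test_functional_add[OF L ind[OF AB(1)] ind[OF AB(2)]]
          test_functional_le(1)[OF L] ind AB
        by (simp add: l_def ennreal_plus)
    qed
    show "\<forall>A\<in>sets M. l A \<noteq> \<infinity>" by (simp add: l_def)
    show "(\<lambda>i. l (A i)) \<longlonglongrightarrow> 0"
      if A: "range A \<subseteq> sets M" "decseq A" "(\<Inter>i. A i) = {}" for A
    proof (rule tendsto_sandwich[OF _ _ tendsto_const])
      show "(\<lambda>i. emeasure M (A i)) \<longlonglongrightarrow> 0"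
        using Lim_emeasure_decseq[of A M] A by simp
    qed (use A l_le in \<open>auto intro!: always_eventually\<close>)
  qed fact
  ultimately have em: "emeasure (measure_of (space M) (sets M) l) A = l A" if "A \<in> sets M" for A
    using that by (intro emeasure_measure_of_sigma) (auto intro: sets.sigma_algebra_axioms)
  define N where "N = measure_of (space M) (sets M) l"
  have N: "sets N = sets M" "space N = space M" by (auto simp: N_def)
  have em: "emeasure N A = l A" if "A \<in> sets M" for A
    using em[OF that] by (simp add: N_def)
  have "finite_measure N"
    by (rule finite_measureI) (simp add: N em l_def)
  moreover have "absolutely_continuous M N"
    unfolding absolutely_continuous_def
  proof
    fix A assume "A \<in> null_sets M"
    then show "A \<in> null_sets N"
      using l_le[of A] em[of A] by (auto simp: null_sets_def N)
  qed
  ultimately obtain f where [measurable]: "f \<in> borel_measurable M" and f: "density M f = N"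
    using Radon_Nikodym_finite_measure[of N] N by auto
  have f1: "AE x in M. f x \<le> 1"
    by (rule AE_density_le_1) (use f em l_le in auto)
  \<comment> \<open>Radon-Nikodym yields an \<open>ennreal\<close> density that is at most 1 only
    almost everywhere. Clipping gives a real function with values in [0, 1] everywhere, as the later
    pointwise gluing requires.\<close>
  define f' where "f' x = enn2real (min 1 (f x))" for x
  have "ennreal (f' x) = min 1 (f x)" for x
    unfolding f'_def by (subst ennreal_enn2real) (auto simp: min_less_iff_disj)
  then have f': "AE x in M. ennreal (f' x) = f x"
    using f1 by (auto simp: min_def elim!: eventually_mono)
  show ?thesis
  proof (intro bexI conjI ballI allI)
    show "0 \<le> f' x" for x by (simp add: f'_def)
    have "enn2real (min 1 (f x)) \<le> enn2real 1" for x
      by (intro enn2real_mono) auto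
    then show "f' x \<le> 1" for x by (simp add: f'_def)
    show "f' \<in> borel_measurable M" unfolding f'_def by measurable
    fix A assume A[measurable]: "A \<in> sets M"
    have "(\<integral>\<^sup>+x. ennreal (f' x) * indicator A x \<partial>M) = (\<integral>\<^sup>+x. f x * indicator A x \<partial>M)"
      using f' by (intro nn_integral_cong_AE) auto
    also have "\<dots> = l A"
      using em[OF A] unfolding f[symmetric] by (simp add: emeasure_density)
    finally show "ennreal (L (density M (indicator A))) = (\<integral>\<^sup>+x. ennreal (f' x) * indicator A x \<partial>M)"
      by (simp add: l_def)
  qed
qed

text \<open>Indicators extend to integrable functions by the usual induction. The monotone limit
  needs an argument of its own, since no monotone convergence is available for \<open>L\<close>: its
  value on the remainder is squeezed by an integral that tends to 0.\<close>

lemma test_functional_representation: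
  assumes L: "L \<in> test_functionals M"
  shows "\<exists>f\<in>borel_measurable M. (\<forall>x. 0 \<le> f x \<and> f x \<le> (1::real)) \<and>
    (\<forall>g\<in>borel_measurable M. (\<integral>\<^sup>+x. g x \<partial>M) < \<infinity> \<longrightarrow>
      ennreal (L (density M g)) = (\<integral>\<^sup>+x. ennreal (f x) * g x \<partial>M))"
proof -
  obtain f where f[measurable]: "f \<in> borel_measurable M" and f01: "\<And>x. 0 \<le> f x" "\<And>x. f x \<le> (1::real)"
    and fA: "\<And>A. A \<in> sets M \<Longrightarrow>
      ennreal (L (density M (indicator A))) = (\<integral>\<^sup>+x. ennreal (f x) * indicator A x \<partial>M)"
    using test_functional_representation_indicator[OF L] by blast
  have "ennreal (L (density M g)) = (\<integral>\<^sup>+x. ennreal (f x) * g x \<partial>M)"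
    if "g \<in> borel_measurable M" "(\<integral>\<^sup>+x. g x \<partial>M) < \<infinity>" for g
    using that
  proof (induction g rule: borel_measurable_induct)
    case (cong g h)
    have "density M g = density M h"
      using cong.hyps by (intro density_cong) auto
    moreover have "(\<integral>\<^sup>+x. g x \<partial>M) = (\<integral>\<^sup>+x. h x \<partial>M)"
      "(\<integral>\<^sup>+x. ennreal (f x) * g x \<partial>M) = (\<integral>\<^sup>+x. ennreal (f x) * h x \<partial>M)"
      using cong.hyps by (auto intro!: nn_integral_cong)
    ultimately show ?case using cong.IH cong.prems by metis
  next
    case (set A)
    then show ?case using fA by simp
  next
    case (mult u c)
    obtain r where r: "c = ennreal r" "0 \<le> r"
      using mult.hyps(1) by (cases c) auto
    show ?case
    proof (cases "r = 0")
      \<comment> \<open>With factor 0 the product is integrable even if \<open>u\<close> is not, so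
        the induction hypothesis may say nothing about \<open>u\<close>.\<close>
      case True
      then show ?thesis
        using test_functional_cmult[OF L, of "\<lambda>_. 0" 0] r by simp
    next
      case False
      then have fin: "(\<integral>\<^sup>+x. u x \<partial>M) < \<infinity>"
        using mult.prems mult.hyps(2) r
        by (auto simp: nn_integral_cmult ennreal_mult_less_top)
      have "ennreal (L (density M (\<lambda>x. c * u x))) = c * ennreal (L (density M u))"
        using test_functional_cmult[OF L mult.hyps(2) fin r(2)] r test_functional_le(1)[OF L mult.hyps(2) fin]
        by (simp add: ennreal_mult)
      also have "\<dots> = c * (\<integral>\<^sup>+x. ennreal (f x) * u x \<partial>M)"
        using mult.IH fin by simp
      also have "\<dots> = (\<integral>\<^sup>+x. ennreal (f x) * (c * u x) \<partial>M)"
        using mult.hyps(2) by (subst nn_integral_cmult[symmetric]) (auto simp: ac_simps)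
      finally show ?thesis .
    qed
  next
    case (add u v)
    have fin: "(\<integral>\<^sup>+x. u x \<partial>M) < \<infinity>" "(\<integral>\<^sup>+x. v x \<partial>M) < \<infinity>"
      using add.prems add.hyps by (auto simp: nn_integral_add)
    have "ennreal (L (density M (\<lambda>x. v x + u x))) = ennreal (L (density M v)) + ennreal (L (density M u))"
      using test_functional_add[OF L] test_functional_le(1)[OF L] add.hyps fin
      by (simp add: ennreal_plus)
    also have "\<dots> = (\<integral>\<^sup>+x. ennreal (f x) * (v x + u x) \<partial>M)"
      using add.IH fin add.hyps by (simp add: distrib_left nn_integral_add)
    finally show ?case .
  next
    case (seq U)
    define g where "g = (SUP i. U i)"
    have g: "g x = (SUP i. U i x)" for x by (simp add: g_def image_comp)
    have U[measurable]: "\<And>i. U i \<in> borel_measurable M" by fact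
    have [measurable]: "g \<in> borel_measurable M"
      by (subst measurable_cong[OF g]) measurable
    have U_le: "U i x \<le> g x" for i x unfolding g by (rule SUP_upper) auto
    have fin_g: "(\<integral>\<^sup>+x. g x \<partial>M) < \<infinity>" using seq.prems by (simp add: g_def)
    have fin: "(\<integral>\<^sup>+x. U i x \<partial>M) < \<infinity>" for i
      using nn_integral_mono[of M "U i" g] U_le fin_g by (metis le_less_trans)
    have fin': "(\<integral>\<^sup>+x. g x - U i x \<partial>M) < \<infinity>" for i
      using nn_integral_mono[of M "\<lambda>x. g x - U i x" g] fin_g
      by (metis le_less_trans diff_le_self_ennreal)
    \<comment> \<open>Additivity splits off the remainder \<open>g - U i\<close>, and
      \<open>L\<close> of its density is at most its integral. That integral vanishes in the limit
      because \<open>g\<close> is integrable.\<close>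
    have "density M g = density M (\<lambda>x. U i x + (g x - U i x))" for i
      using seq.hyps(2)[of _ i] U_le
      by (intro density_cong) (auto simp: add_diff_inverse_ennreal)
    then have sum: "L (density M g) = L (density M (U i)) + L (density M (\<lambda>x. g x - U i x))" for i
      using test_functional_add[OF L U[of i] fin[of i] _ fin'[of i]] by simp
    have split: "ennreal (L (density M g)) =
        ennreal (L (density M (U i))) + ennreal (L (density M (\<lambda>x. g x - U i x)))" for i
      unfolding sum[of i]
      using test_functional_le(1)[OF L _ fin[of i]] test_functional_le(1)[OF L _ fin'[of i]]
      by (intro ennreal_plus) auto
    have diff: "(\<integral>\<^sup>+x. g x - U i x \<partial>M) = (\<integral>\<^sup>+x. g x \<partial>M) - (\<integral>\<^sup>+x. U i x \<partial>M)" for i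
      using fin[of i] U_le by (intro nn_integral_diff) auto
    have lim: "(\<lambda>i. \<integral>\<^sup>+x. h x * U i x \<partial>M) \<longlonglongrightarrow> (\<integral>\<^sup>+x. h x * g x \<partial>M)"
      if [measurable]: "h \<in> borel_measurable M" for h
    proof -
      have inc: "incseq (\<lambda>i x. h x * U i x)"
        using \<open>incseq U\<close> by (auto simp: incseq_def le_fun_def intro!: mult_left_mono)
      have "(\<integral>\<^sup>+x. h x * g x \<partial>M) = (SUP i. \<integral>\<^sup>+x. h x * U i x \<partial>M)"
        using nn_integral_monotone_convergence_SUP[OF inc] by (simp add: g SUP_mult_left_ennreal)
      moreover have "incseq (\<lambda>i. \<integral>\<^sup>+x. h x * U i x \<partial>M)"
        using inc by (auto simp: incseq_def le_fun_def intro!: nn_integral_mono)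
      ultimately show ?thesis by (metis LIMSEQ_SUP)
    qed
    have "(\<lambda>i. (\<integral>\<^sup>+x. g x \<partial>M) - (\<integral>\<^sup>+x. U i x \<partial>M)) \<longlonglongrightarrow> (\<integral>\<^sup>+x. g x \<partial>M) - (\<integral>\<^sup>+x. g x \<partial>M)"
      using lim[of "\<lambda>_. 1"] fin_g by (intro tendsto_diff_ennreal) auto
    then have diff_lim: "(\<lambda>i. \<integral>\<^sup>+x. g x - U i x \<partial>M) \<longlonglongrightarrow> 0"
      using fin_g by (simp add: diff)
    have "(\<lambda>i. ennreal (L (density M (\<lambda>x. g x - U i x)))) \<longlonglongrightarrow> 0"
      by (rule tendsto_sandwich[OF _ _ tendsto_const diff_lim])
        (use test_functional_le(2)[OF L _ fin'] in \<open>auto intro!: always_eventually\<close>)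
    then have "(\<lambda>i. ennreal (L (density M (U i))) + ennreal (L (density M (\<lambda>x. g x - U i x))))
        \<longlonglongrightarrow> (\<integral>\<^sup>+x. ennreal (f x) * g x \<partial>M) + 0"
      using lim[of "\<lambda>x. ennreal (f x)"] seq.IH fin by (intro tendsto_add) auto
    then have "(\<lambda>i. ennreal (L (density M g))) \<longlonglongrightarrow> (\<integral>\<^sup>+x. ennreal (f x) * g x \<partial>M)"
      by (simp flip: split)
    then have "ennreal (L (density M g)) = (\<integral>\<^sup>+x. ennreal (f x) * g x \<partial>M)"
      by (simp add: LIMSEQ_const_iff)
    then show ?case by (simp only: g_def)
  qed
  then show ?thesis using f f01 by blast
qed

end

section \<open>Total variation and mixtures\<close>

text \<open>Restricting both measures to \<open>Y\<close> by an indicator density turns a comparison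
  on the subsets of \<open>Y\<close> into the order on measures, for which monotonicity of the
  integral is known.\<close>

lemma set_nn_integral_mono_measure:
  assumes sets: "sets \<mu> = sets \<nu>" and Y: "Y \<in> sets \<mu>" and g: "g \<in> borel_measurable \<mu>"
    and le: "\<And>X. X \<in> sets \<mu> \<Longrightarrow> X \<subseteq> Y \<Longrightarrow> emeasure \<mu> X \<le> emeasure \<nu> X"
  shows "(\<integral>\<^sup>+x\<in>Y. g x \<partial>\<mu>) \<le> (\<integral>\<^sup>+x\<in>Y. g x \<partial>\<nu>)"
proof -
  have Y': "Y \<in> sets \<nu>" and g': "g \<in> borel_measurable \<nu>"
    using Y g sets measurable_cong_sets by blast+
  have "emeasure (density \<mu> (indicator Y)) A \<le> emeasure (density \<nu> (indicator Y)) A"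
    if "A \<in> sets \<mu>" for A
    using that le[of "A \<inter> Y"] Y Y' sets by (simp add: emeasure_restricted Int_commute)
  then have "density \<mu> (indicator Y) \<le> density \<nu> (indicator Y)"
    by (subst le_measure) (auto simp: sets)
  then have "(\<integral>\<^sup>+x. g x \<partial>density \<mu> (indicator Y)) \<le> (\<integral>\<^sup>+x. g x \<partial>density \<nu> (indicator Y))"
    by (intro nn_integral_mono_measure) (simp_all add: sets)
  then show ?thesis
    using Y Y' g g' by (simp add: nn_integral_density mult.commute)
qed

lemma set_integral_mono_measure:
  fixes g :: "'a \<Rightarrow> real"
  assumes "finite_measure \<nu>" "sets \<mu> = sets \<nu>" "Y \<in> sets \<mu>" "g \<in> borel_measurable \<mu>"
    and g01: "\<And>x. 0 \<le> g x" "\<And>x. g x \<le> 1"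
    and le: "\<And>X. X \<in> sets \<mu> \<Longrightarrow> X \<subseteq> Y \<Longrightarrow> emeasure \<mu> X \<le> emeasure \<nu> X"
  shows "(\<integral>x. g x * indicator Y x \<partial>\<mu>) \<le> (\<integral>x. g x * indicator Y x \<partial>\<nu>)"
proof -
  interpret finite_measure \<nu> by fact
  have [measurable]: "Y \<in> sets \<mu>" "Y \<in> sets \<nu>" "g \<in> borel_measurable \<mu>"
    using assms(2-4) by auto
  have [measurable]: "g \<in> borel_measurable \<nu>"
    using assms(4) by (simp cong: measurable_cong_sets add: assms(2)[symmetric])
  have "(\<integral>\<^sup>+x. ennreal (g x) * indicator Y x \<partial>\<nu>) \<le> (\<integral>\<^sup>+x. 1 \<partial>\<nu>)"
    using g01 by (intro nn_integral_mono) (auto simp: indicator_def)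
  also have "\<dots> < \<infinity>"
    by (simp add: less_top[symmetric])
  finally have "(\<integral>\<^sup>+x. ennreal (g x) * indicator Y x \<partial>\<nu>) < \<infinity>" .
  moreover have "(\<integral>\<^sup>+x. ennreal (g x) * indicator Y x \<partial>\<mu>) \<le> (\<integral>\<^sup>+x. ennreal (g x) * indicator Y x \<partial>\<nu>)"
    by (intro set_nn_integral_mono_measure assms(2) le) auto
  ultimately have "enn2real (\<integral>\<^sup>+x. ennreal (g x) * indicator Y x \<partial>\<mu>)
      \<le> enn2real (\<integral>\<^sup>+x. ennreal (g x) * indicator Y x \<partial>\<nu>)"
    by (intro enn2real_mono) auto
  moreover have "(\<integral>x. g x * indicator Y x \<partial>\<rho>) = enn2real (\<integral>\<^sup>+x. ennreal (g x) * indicator Y x \<partial>\<rho>)"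
    if "(\<lambda>x. g x * indicator Y x) \<in> borel_measurable \<rho>" for \<rho>
    using that g01 by (subst integral_eq_nn_integral) (auto simp: ennreal_mult' ennreal_indicator)
  ultimately show ?thesis by simp
qed

lemma integrable_unit_interval:
  fixes g :: "'a \<Rightarrow> real"
  assumes "finite_measure \<mu>" "g \<in> borel_measurable \<mu>" "\<And>x. 0 \<le> g x" "\<And>x. g x \<le> 1"
  shows "integrable \<mu> g"
proof -
  interpret finite_measure \<mu> by fact
  show ?thesis using assms by (intro integrable_const_bound[of _ 1]) auto
qed

text \<open>\<open>Y\<close> is the Hahn set on which \<nu> dominates \<mu>, and \<open>Z\<close> is
  its complement. Both measures have mass 1, so the surplus on \<open>Y\<close> equals the deficit
  on \<open>Z\<close>; the partition into \<open>Y\<close> and \<open>Z\<close> attains the supremum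
  and accounts for the factor 2. The indicator of \<open>Y\<close> is also the best test between the
  two measures.\<close>

lemma tv_norm_attained:
  assumes \<mu>: "prob_space \<mu>" and \<nu>: "prob_space \<nu>" and sets: "sets \<mu> = sets \<nu>"
  shows "\<exists>Y\<in>sets \<mu>. tv_norm \<mu> \<nu> / 2 = measure \<nu> Y - measure \<mu> Y \<and>
    (\<forall>g\<in>borel_measurable \<mu>. (\<forall>x. 0 \<le> g x \<and> g x \<le> 1) \<longrightarrow>
      (\<integral>x. g x \<partial>\<nu>) - (\<integral>x. g x \<partial>\<mu>) \<le> measure \<nu> Y - measure \<mu> Y)"
proof -
  interpret \<mu>: prob_space \<mu> by fact
  interpret \<nu>: prob_space \<nu> by fact
  have space: "space \<mu> = space \<nu>" using sets by (rule sets_eq_imp_space_eq)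
  obtain Y where Y: "Y \<in> sets \<nu>"
    and le: "\<And>X. X \<in> sets \<nu> \<Longrightarrow> X \<subseteq> Y \<Longrightarrow> emeasure \<mu> X \<le> emeasure \<nu> X"
    and ge: "\<And>X. X \<in> sets \<nu> \<Longrightarrow> X \<inter> Y = {} \<Longrightarrow> emeasure \<nu> X \<le> emeasure \<mu> X"
    using finite_unsigned_Hahn_decomposition[of \<nu> \<mu>] sets
      \<mu>.finite_measure_axioms \<nu>.finite_measure_axioms by metis
  define Z where "Z = space \<nu> - Y"
  have YZ[measurable]: "Y \<in> sets \<nu>" "Z \<in> sets \<nu>" "Y \<in> sets \<mu>" "Z \<in> sets \<mu>"
    using Y sets by (auto simp: Z_def)
  have le': "measure \<mu> X \<le> measure \<nu> X" if "X \<in> sets \<nu>" "X \<subseteq> Y" for X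
    using le[OF that] by (simp add: \<mu>.emeasure_eq_measure \<nu>.emeasure_eq_measure)
  have ge': "measure \<nu> X \<le> measure \<mu> X" if "X \<in> sets \<nu>" "X \<subseteq> Z" for X
    using ge[of X] that by (force simp: Z_def \<mu>.emeasure_eq_measure \<nu>.emeasure_eq_measure)
  have Z: "measure \<mu> Z = 1 - measure \<mu> Y" "measure \<nu> Z = 1 - measure \<nu> Y"
    using YZ \<mu>.prob_compl[of Y] \<nu>.prob_compl[of Y] by (simp_all add: Z_def space)
  have "tv_norm \<mu> \<nu> = 2 * (measure \<nu> Y - measure \<mu> Y)"
    unfolding tv_norm_def
  proof (rule cSup_eq_maximum)
    \<comment> \<open>If the complementary sets coincided, the space would be empty. They must
      differ because a sum over the set \<open>{Y, Z}\<close> would otherwise have one term instead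
      of two.\<close>
    have "Y \<noteq> Z" using \<nu>.not_empty by (auto simp: Z_def)
    then have "(\<Sum>A\<in>{Y, Z}. \<bar>measure \<mu> A - measure \<nu> A\<bar>) = 2 * (measure \<nu> Y - measure \<mu> Y)"
      using le'[of Y] ge'[of Z] YZ Z by simp
    moreover have "{Y, Z} \<subseteq> sets \<mu>" "disjoint {Y, Z}" "\<Union>{Y, Z} = space \<mu>"
      using YZ sets.sets_into_space[OF Y] by (auto simp: Z_def disjoint_def space)
    ultimately show "2 * (measure \<nu> Y - measure \<mu> Y) \<in> {(\<Sum>A\<in>\<A>. \<bar>measure \<mu> A - measure \<nu> A\<bar>) | \<A>.
        finite \<A> \<and> \<A> \<subseteq> sets \<mu> \<and> disjoint \<A> \<and> \<Union>\<A> = space \<mu>}"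
      by (intro CollectI exI[of _ "{Y, Z}"]) auto
  next
    fix t assume "t \<in> {(\<Sum>A\<in>\<A>. \<bar>measure \<mu> A - measure \<nu> A\<bar>) | \<A>.
        finite \<A> \<and> \<A> \<subseteq> sets \<mu> \<and> disjoint \<A> \<and> \<Union>\<A> = space \<mu>}"
    then obtain \<A> where t: "t = (\<Sum>A\<in>\<A>. \<bar>measure \<mu> A - measure \<nu> A\<bar>)"
      and \<A>: "finite \<A>" "\<A> \<subseteq> sets \<mu>" "disjoint \<A>" "\<Union>\<A> = space \<mu>" by blast
    have part: "(\<Sum>A\<in>\<A>. measure \<rho> (A \<inter> B)) = measure \<rho> B"
      if "prob_space \<rho>" "sets \<rho> = sets \<mu>" "B \<in> sets \<mu>" for \<rho> B
    proof -
      interpret \<rho>: prob_space \<rho> by fact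
      have "(\<Sum>A\<in>\<A>. measure \<rho> (A \<inter> B)) = measure \<rho> (\<Union>A\<in>\<A>. A \<inter> B)"
        using \<A> that
        by (intro \<rho>.finite_measure_finite_Union[symmetric])
          (auto simp: disjoint_family_on_def disjoint_def)
      also have "(\<Union>A\<in>\<A>. A \<inter> B) = B"
        using \<A>(4) sets.sets_into_space[OF that(3)] by auto
      finally show ?thesis .
    qed
    have "\<bar>measure \<mu> A - measure \<nu> A\<bar> \<le>
        (measure \<nu> (A \<inter> Y) - measure \<mu> (A \<inter> Y)) + (measure \<mu> (A \<inter> Z) - measure \<nu> (A \<inter> Z))"
      if A: "A \<in> \<A>" for A
    proof -
      have A': "A \<in> sets \<mu>" "A \<in> sets \<nu>" using A \<A> sets by auto
      have "A = (A \<inter> Y) \<union> (A \<inter> Z)"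
        using sets.sets_into_space[OF A'(2)] by (auto simp: Z_def)
      moreover have "(A \<inter> Y) \<inter> (A \<inter> Z) = {}" by (auto simp: Z_def)
      ultimately have "measure \<mu> A = measure \<mu> (A \<inter> Y) + measure \<mu> (A \<inter> Z)"
        "measure \<nu> A = measure \<nu> (A \<inter> Y) + measure \<nu> (A \<inter> Z)"
        using \<mu>.finite_measure_Union[of "A \<inter> Y" "A \<inter> Z"] \<nu>.finite_measure_Union[of "A \<inter> Y" "A \<inter> Z"]
          A' YZ by auto
      with le'[of "A \<inter> Y"] ge'[of "A \<inter> Z"] A' YZ show ?thesis by auto
    qed
    then have "t \<le> (\<Sum>A\<in>\<A>. (measure \<nu> (A \<inter> Y) - measure \<mu> (A \<inter> Y))
        + (measure \<mu> (A \<inter> Z) - measure \<nu> (A \<inter> Z)))"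
      unfolding t by (intro sum_mono) auto
    also have "\<dots> = 2 * (measure \<nu> Y - measure \<mu> Y)"
      using YZ Z sets \<mu> \<nu> by (simp add: sum.distrib sum_subtractf part)
    finally show "t \<le> 2 * (measure \<nu> Y - measure \<mu> Y)" .
  qed
  moreover have "(\<integral>x. g x \<partial>\<nu>) - (\<integral>x. g x \<partial>\<mu>) \<le> measure \<nu> Y - measure \<mu> Y"
    if g: "g \<in> borel_measurable \<mu>" and g01: "\<And>x. 0 \<le> g x" "\<And>x. g x \<le> 1" for g :: "'a \<Rightarrow> real"
  proof -
    have [measurable]: "g \<in> borel_measurable \<mu>" "g \<in> borel_measurable \<nu>"
      using g sets measurable_cong_sets by blast+
    \<comment> \<open>This writes the integral of \<open>g\<close> as the mass of \<open>Y\<close>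
      with two corrections: what \<open>g\<close> misses on \<open>Y\<close> and what it adds on
      \<open>Z\<close>. The first is at least as large for \<nu> as for \<mu>, the second at most as
      large, so neither can increase the difference.\<close>
    have split: "(\<integral>x. g x \<partial>\<rho>) = measure \<rho> Y - (\<integral>x. (1 - g x) * indicator Y x \<partial>\<rho>)
        + (\<integral>x. g x * indicator Z x \<partial>\<rho>)"
      if "prob_space \<rho>" "sets \<rho> = sets \<nu>" for \<rho>
    proof -
      interpret \<rho>: prob_space \<rho> by fact
      have [measurable]: "g \<in> borel_measurable \<rho>" "Y \<in> sets \<rho>" "Z \<in> sets \<rho>"
        using g sets that YZ measurable_cong_sets by blast+
      have int: "integrable \<rho> (\<lambda>x. (1 - g x) * indicator Y x)" "integrable \<rho> (\<lambda>x. g x * indicator Z x)"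
        "integrable \<rho> (indicator Y :: _ \<Rightarrow> real)"
        using g01 by (auto intro!: integrable_unit_interval \<rho>.finite_measure_axioms simp: indicator_def)
      have "(\<integral>x. g x \<partial>\<rho>) = (\<integral>x. indicator Y x - (1 - g x) * indicator Y x + g x * indicator Z x \<partial>\<rho>)"
        using sets_eq_imp_space_eq[OF that(2)]
        by (intro Bochner_Integration.integral_cong) (auto simp: Z_def indicator_def)
      then show ?thesis
        using int by simp
    qed
    have "(\<integral>x. (1 - g x) * indicator Y x \<partial>\<mu>) \<le> (\<integral>x. (1 - g x) * indicator Y x \<partial>\<nu>)"
      using g01 le sets by (intro set_integral_mono_measure \<nu>.finite_measure_axioms) auto
    moreover have "(\<integral>x. g x * indicator Z x \<partial>\<nu>) \<le> (\<integral>x. g x * indicator Z x \<partial>\<mu>)"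
      using g01 sets by (intro set_integral_mono_measure \<mu>.finite_measure_axioms ge) (auto simp: Z_def)
    ultimately show ?thesis
      using split[OF \<mu> sets] split[OF \<nu> refl] by linarith
  qed
  ultimately show ?thesis
    using \<open>Y \<in> sets \<mu>\<close> by (intro bexI[of _ Y] conjI ballI impI) simp_all
qed

text \<open>\<open>co\<close> describes its members by their values on sets. To exhibit a member
  with given weights, the weighted sum must first be realized by a measure.\<close>

lemma mixture_exists:
  fixes q :: "nat \<Rightarrow> 'a measure"
  assumes "\<And>i. i < n \<Longrightarrow> sets (q i) = sets M"
  shows "\<exists>N. sets N = sets M \<and>
    (\<forall>A\<in>sets M. emeasure N A = (\<Sum>i<n. ennreal (c i) * emeasure (q i) A))"
proof -
  let ?m = "\<lambda>A. \<Sum>i<n. ennreal (c i) * emeasure (q i) A"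
  have "countably_additive (sets M) ?m"
  proof (rule countably_additiveI)
    fix A :: "nat \<Rightarrow> 'a set" assume A: "range A \<subseteq> sets M" "disjoint_family A"
    have "(\<Sum>k. ?m (A k)) = (\<Sum>i<n. \<Sum>k. ennreal (c i) * emeasure (q i) (A k))"
      by (rule suminf_sum) simp
    also have "\<dots> = ?m (\<Union>k. A k)"
      using A assms by (intro sum.cong) (auto simp: suminf_emeasure)
    finally show "(\<Sum>k. ?m (A k)) = ?m (\<Union>k. A k)" .
  qed
  moreover have "positive (sets M) ?m" by (simp add: positive_def)
  ultimately show ?thesis
    by (intro exI[of _ "measure_of (space M) (sets M) ?m"])
      (auto intro!: emeasure_measure_of_sigma sets.sigma_algebra_axioms)
qed

lemma nn_integral_mixture:
  fixes q :: "nat \<Rightarrow> 'a measure"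
  assumes sets: "\<And>i. i < n \<Longrightarrow> sets (q i) = sets N"
    and em: "\<And>A. A \<in> sets N \<Longrightarrow> emeasure N A = (\<Sum>i<n. ennreal (c i) * emeasure (q i) A)"
    and "g \<in> borel_measurable N"
  shows "(\<integral>\<^sup>+x. g x \<partial>N) = (\<Sum>i<n. ennreal (c i) * (\<integral>\<^sup>+x. g x \<partial>q i))"
  using \<open>g \<in> borel_measurable N\<close>
proof (induction g rule: borel_measurable_induct)
  case (cong g h)
  have "(\<integral>\<^sup>+x. g x \<partial>N) = (\<integral>\<^sup>+x. h x \<partial>N)"
    using cong.hyps by (intro nn_integral_cong) auto
  moreover have "(\<integral>\<^sup>+x. g x \<partial>q i) = (\<integral>\<^sup>+x. h x \<partial>q i)" if "i < n" for i
    using cong.hyps sets_eq_imp_space_eq[OF sets[OF that]] by (intro nn_integral_cong) auto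
  ultimately show ?case using cong.IH by simp
next
  case (set A)
  then show ?case using em sets by simp
next
  case (mult u a)
  have "u \<in> borel_measurable (q i)" if "i < n" for i
    using mult.hyps sets[OF that] measurable_cong_sets by blast
  then show ?case
    using mult by (simp add: nn_integral_cmult sum_distrib_left ac_simps)
next
  case (add u v)
  have "u \<in> borel_measurable (q i)" "v \<in> borel_measurable (q i)" if "i < n" for i
    using add.hyps sets[OF that] measurable_cong_sets by blast+
  then show ?case
    using add by (simp add: nn_integral_add sum.distrib distrib_left)
next
  case (seq U)
  have U: "U k \<in> borel_measurable (q i)" if "i < n" for i k
    using seq.hyps(1) sets[OF that] measurable_cong_sets by blast
  have lim: "(\<lambda>k. \<integral>\<^sup>+x. U k x \<partial>\<rho>) \<longlonglongrightarrow> (\<integral>\<^sup>+x. (SUP i. U i) x \<partial>\<rho>)"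
    if "\<And>k. U k \<in> borel_measurable \<rho>" for \<rho>
  proof -
    have "(\<integral>\<^sup>+x. (SUP i. U i) x \<partial>\<rho>) = (SUP k. \<integral>\<^sup>+x. U k x \<partial>\<rho>)"
      using nn_integral_monotone_convergence_SUP[OF \<open>incseq U\<close> that] by (simp add: image_comp)
    moreover have "incseq (\<lambda>k. \<integral>\<^sup>+x. U k x \<partial>\<rho>)"
      using \<open>incseq U\<close> by (auto simp: incseq_def le_fun_def intro!: nn_integral_mono)
    ultimately show ?thesis by (metis LIMSEQ_SUP)
  qed
  have "(\<lambda>k. \<Sum>i<n. ennreal (c i) * (\<integral>\<^sup>+x. U k x \<partial>q i))
      \<longlonglongrightarrow> (\<Sum>i<n. ennreal (c i) * (\<integral>\<^sup>+x. (SUP i. U i) x \<partial>q i))"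
    using U by (intro tendsto_sum ennreal_tendsto_cmult lim) auto
  then have "(\<lambda>k. \<integral>\<^sup>+x. U k x \<partial>N) \<longlonglongrightarrow> (\<Sum>i<n. ennreal (c i) * (\<integral>\<^sup>+x. (SUP i. U i) x \<partial>q i))"
    using seq.IH by simp
  moreover have "(\<lambda>k. \<integral>\<^sup>+x. U k x \<partial>N) \<longlonglongrightarrow> (\<integral>\<^sup>+x. (SUP i. U i) x \<partial>N)"
    by (rule lim) (rule seq.hyps(1))
  ultimately show ?case
    by (intro LIMSEQ_unique[of _ "\<integral>\<^sup>+x. (SUP i. U i) x \<partial>N"])
qed

lemma integral_mixture:
  fixes q :: "nat \<Rightarrow> 'a measure" and g :: "'a \<Rightarrow> real"
  assumes q: "\<And>i. i < n \<Longrightarrow> prob_space (q i)" "\<And>i. i < n \<Longrightarrow> sets (q i) = sets N"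
    and c: "\<And>i. i < n \<Longrightarrow> 0 \<le> c i"
    and em: "\<And>A. A \<in> sets N \<Longrightarrow> emeasure N A = (\<Sum>i<n. ennreal (c i) * emeasure (q i) A)"
    and g: "g \<in> borel_measurable N" "\<And>x. 0 \<le> g x" "\<And>x. g x \<le> 1"
  shows "(\<integral>x. g x \<partial>N) = (\<Sum>i<n. c i * (\<integral>x. g x \<partial>q i))"
proof -
  have "(\<integral>\<^sup>+x. ennreal (g x) \<partial>N) = (\<Sum>i<n. ennreal (c i) * (\<integral>\<^sup>+x. ennreal (g x) \<partial>q i))"
    using q em g by (intro nn_integral_mixture) auto
  also have "\<dots> = (\<Sum>i<n. ennreal (c i * (\<integral>x. g x \<partial>q i)))"
  proof (intro sum.cong refl)
    fix i assume "i \<in> {..<n}"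
    then have i: "i < n" by simp
    interpret prob_space "q i" using q i by blast
    have "g \<in> borel_measurable (q i)"
      using g(1) q(2)[OF i] measurable_cong_sets by blast
    then have "(\<integral>\<^sup>+x. ennreal (g x) \<partial>q i) = ennreal (\<integral>x. g x \<partial>q i)"
      using g(2,3) by (intro nn_integral_eq_integral integrable_unit_interval finite_measure_axioms) auto
    then show "ennreal (c i) * (\<integral>\<^sup>+x. ennreal (g x) \<partial>q i) = ennreal (c i * (\<integral>x. g x \<partial>q i))"
      using c[OF i] g(2) by (simp add: ennreal_mult)
  qed
  also have "\<dots> = ennreal (\<Sum>i<n. c i * (\<integral>x. g x \<partial>q i))"
    using c g(2) by (intro sum_ennreal) (auto intro!: mult_nonneg_nonneg integral_nonneg_AE)
  finally have "enn2real (\<integral>\<^sup>+x. ennreal (g x) \<partial>N) = enn2real (ennreal (\<Sum>i<n. c i * (\<integral>x. g x \<partial>q i)))"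
    by simp
  also have "\<dots> = (\<Sum>i<n. c i * (\<integral>x. g x \<partial>q i))"
    using c g(2) by (intro enn2real_ennreal sum_nonneg mult_nonneg_nonneg integral_nonneg_AE) auto
  finally have "enn2real (\<integral>\<^sup>+x. ennreal (g x) \<partial>N) = (\<Sum>i<n. c i * (\<integral>x. g x \<partial>q i))" .
  then show ?thesis
    using g by (simp add: integral_eq_nn_integral)
qed

lemma co_prob_space:
  assumes H: "prob_family M H" and N: "N \<in> co M H"
  shows "prob_space N" "sets N = sets M"
proof -
  show sets: "sets N = sets M" using N by (simp add: co_def)
  obtain n and q :: "nat \<Rightarrow> _" and c :: "nat \<Rightarrow> real" where q: "\<forall>i<n. q i \<in> H"
    and c: "\<forall>i<n. 0 \<le> c i" "(\<Sum>i<n. c i) = 1"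
    and em: "\<forall>A\<in>sets M. emeasure N A = (\<Sum>i<n. ennreal (c i) * emeasure (q i) A)"
    using N unfolding co_def by (elim CollectE conjE exE) (rule that)
  show "prob_space N"
  proof
    have "emeasure (q i) (space M) = 1" if "i < n" for i
    proof -
      have "prob_space (q i)" "sets (q i) = sets M"
        using q H that by (auto simp: prob_family_def)
      then show ?thesis
        using prob_space.emeasure_space_1[of "q i"] sets_eq_imp_space_eq[of "q i" M] by simp
    qed
    then have "emeasure N (space M) = (\<Sum>i<n. ennreal (c i))"
      using em by simp
    also have "\<dots> = 1"
      using c by (subst sum_ennreal) auto
    finally show "emeasure N (space N) = 1"
      using sets_eq_imp_space_eq[OF sets] by simp
  qed
qed

section \<open>Hahn extension and canonical extensions\<close>

locale disjoint_supports =
  fixes M :: "'a measure" and Q :: "'a measure set" and S :: "'a measure \<Rightarrow> 'a set"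
  assumes S: "q \<in> Q \<Longrightarrow> S q \<in> sets M"
    and disjoint: "q \<in> Q \<Longrightarrow> r \<in> Q \<Longrightarrow> q \<noteq> r \<Longrightarrow> S q \<inter> S r = {}"
begin

lemma hahn_gen_Pow: "hahn_gen M Q S \<subseteq> Pow (space M)"
  using sets.sets_into_space by (fastforce simp: hahn_gen_def)

lemma space_hahn_ext: "space (hahn_ext M Q S) = space M"
  using hahn_gen_Pow by (simp add: hahn_ext_def space_measure_of)

lemma sets_hahn_ext: "sets (hahn_ext M Q S) = sigma_sets (space M) (hahn_gen M Q S)"
  using hahn_gen_Pow by (simp add: hahn_ext_def sets_measure_of)

lemma UN_in_hahn_ext:
  assumes "\<And>q. q \<in> Q \<Longrightarrow> E q \<in> sets M" "\<And>q. q \<in> Q \<Longrightarrow> E q \<subseteq> S q"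
  shows "(\<Union>q\<in>Q. E q) \<in> sets (hahn_ext M Q S)"
  unfolding sets_hahn_ext hahn_gen_def
  using assms by (intro sigma_sets.Basic UnI2 CollectI exI[of _ E] conjI ballI refl) auto

text \<open>By disjointness, only the piece \<open>E q\<close> of a generating union meets
  \<open>S q\<close>, and the sets with a measurable trace on \<open>S q\<close> are closed under
  complements and countable unions. The Hahn extension thus adds no new sets inside a single
  support.\<close>

lemma hahn_ext_Int_support:
  assumes "A \<in> sets (hahn_ext M Q S)" and q: "q \<in> Q"
  shows "A \<inter> S q \<in> sets M"
  using assms(1) unfolding sets_hahn_ext
proof (induction rule: sigma_sets.induct)
  case (Basic A)
  consider "A \<in> sets M" | E where "A = (\<Union>r\<in>Q. E r)" "\<And>r. r \<in> Q \<Longrightarrow> E r \<in> sets M \<and> E r \<subseteq> S r"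
    using Basic by (auto simp: hahn_gen_def)
  then show ?case
  proof cases
    case 1
    then show ?thesis using S[OF q] by auto
  next
    case 2
    have "A \<inter> S q = E q"
    proof (intro equalityI subsetI)
      fix x assume x: "x \<in> A \<inter> S q"
      then obtain r where r: "r \<in> Q" "x \<in> E r" using 2(1) by auto
      then have "x \<in> S r \<inter> S q" using 2(2) x by auto
      then have "r = q" using disjoint[OF r(1) q] by auto
      then show "x \<in> E q" using r by simp
    qed (use 2 q in auto)
    then show ?thesis using 2 q by simp
  qed
next
  case Empty
  then show ?case by simp
next
  case (Compl A)
  have "(space M - A) \<inter> S q = S q - A \<inter> S q"
    using sets.sets_into_space[OF S[OF q]] by auto
  then show ?case using Compl.IH S[OF q] by auto
next
  case (Union A)
  have "(\<Union>i. A i) \<inter> S q = (\<Union>i. A i \<inter> S q)" by auto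
  also have "\<dots> \<in> sets M" using Union.IH by (intro sets.countable_UN) auto
  finally show ?case .
qed

text \<open>The identity is measurable from the restriction of \<open>F\<close> to countably many supports into the Hahn
  extension, so canonical extensions are image measures.\<close>

lemma can_ext_eq_distr:
  assumes \<mu>: "sets \<mu> = sets M" and C: "countable C" "Qof Q S \<mu> \<subseteq> C" "C \<subseteq> Q"
  shows "(\<lambda>x. x) \<in> measurable (restrict_space \<mu> (\<Union>(S ` C))) (hahn_ext M Q S)"
    and "can_ext M Q S \<mu> = distr (restrict_space \<mu> (\<Union>(S ` C))) (hahn_ext M Q S) (\<lambda>x. x)"
proof -
  define U where "U = \<Union>(S ` C)"
  have space: "space \<mu> = space M" using \<mu> by (rule sets_eq_imp_space_eq)
  have "U \<in> sets M"
    unfolding U_def using C S by (intro sets.countable_UN') auto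
  then have U: "U \<in> sets \<mu>" "U \<subseteq> space M"
    using \<mu> sets.sets_into_space by auto
  have AS: "A \<inter> S q \<in> sets \<mu>" if "A \<in> sets (hahn_ext M Q S)" "q \<in> C" for A q
    using hahn_ext_Int_support that C \<mu> by auto
  have AU: "A \<inter> U = (\<Union>q\<in>C. A \<inter> S q)" for A by (auto simp: U_def)
  have AU': "A \<inter> U \<in> sets \<mu>" if "A \<in> sets (hahn_ext M Q S)" for A
    unfolding AU using AS that C by (intro sets.countable_UN') auto
  show id: "(\<lambda>x. x) \<in> measurable (restrict_space \<mu> (\<Union>(S ` C))) (hahn_ext M Q S)"
    unfolding U_def[symmetric]
  proof (rule measurableI)
    fix A assume A: "A \<in> sets (hahn_ext M Q S)"
    have "(\<lambda>x. x) -` A \<inter> space (restrict_space \<mu> U) = U \<inter> (A \<inter> U)"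
      using U by (auto simp: space_restrict_space space)
    then show "(\<lambda>x. x) -` A \<inter> space (restrict_space \<mu> U) \<in> sets (restrict_space \<mu> U)"
      using AU'[OF A] by (auto simp: sets_restrict_space)
  qed (use U in \<open>auto simp: space_restrict_space space_hahn_ext space\<close>)
  show "can_ext M Q S \<mu> = distr (restrict_space \<mu> (\<Union>(S ` C))) (hahn_ext M Q S) (\<lambda>x. x)"
    unfolding can_ext_def distr_def space_hahn_ext U_def[symmetric]
  proof (rule measure_of_eq)
    show "sets (hahn_ext M Q S) \<subseteq> Pow (space M)"
      using sets.space_closed[of "hahn_ext M Q S"] by (simp add: space_hahn_ext)
    fix A assume "A \<in> sigma_sets (space M) (sets (hahn_ext M Q S))"
    then have A: "A \<in> sets (hahn_ext M Q S)"
      by (metis sets.sigma_sets_eq space_hahn_ext)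
    have "(\<integral>\<^sup>+q. emeasure \<mu> (A \<inter> S q) \<partial>count_space (Qof Q S \<mu>))
        = (\<integral>\<^sup>+q. emeasure \<mu> (A \<inter> S q) \<partial>count_space C)"
    proof (rule nn_integral_count_space_eq)
      \<comment> \<open>Supports in \<open>C\<close> that \<mu> does not charge contribute nothing,
        so \<open>C\<close> may be enlarged. This allows one countable set to serve several measures
        at once.\<close>
      fix q assume q: "q \<in> C - Qof Q S \<mu>"
      then have "emeasure \<mu> (S q) = 0" using C by (auto simp: Qof_def)
      moreover have "emeasure \<mu> (A \<inter> S q) \<le> emeasure \<mu> (S q)"
        using q C S \<mu> by (intro emeasure_mono) auto
      ultimately show "emeasure \<mu> (A \<inter> S q) = 0" by simp
    qed (use C in auto)
    also have "\<dots> = emeasure \<mu> (\<Union>q\<in>C. A \<inter> S q)"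
      using C disjoint AS[OF A]
      by (intro emeasure_UN_countable[symmetric]) (fastforce simp: disjoint_family_on_def)+
    also have "\<dots> = emeasure (restrict_space \<mu> U) ((\<lambda>x. x) -` A \<inter> space (restrict_space \<mu> U))"
    proof -
      have "(\<lambda>x. x) -` A \<inter> space (restrict_space \<mu> U) = A \<inter> U"
        using U by (auto simp: space_restrict_space space)
      moreover have "U \<inter> space \<mu> \<in> sets \<mu>"
        using U by auto
      ultimately show ?thesis
        unfolding AU[symmetric] by (simp only: emeasure_restrict_space Int_lower2)
    qed
    finally show "(\<integral>\<^sup>+q. emeasure \<mu> (A \<inter> S q) \<partial>count_space (Qof Q S \<mu>))
      = emeasure (restrict_space \<mu> U) ((\<lambda>x. x) -` A \<inter> space (restrict_space \<mu> U))" .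
  qed
qed

lemma Union_supports:
  assumes "countable C" "C \<subseteq> Q"
  shows "\<Union>(S ` C) \<in> sets M"
  using assms S by (intro sets.countable_UN') auto

text \<open>Consequences of the image-measure form: cutting down to countably many supports brings
  sets, functions and integrals back to the original sigma-algebra.\<close>

lemma
  assumes \<mu>: "sets \<mu> = sets M" and C: "countable C" "Qof Q S \<mu> \<subseteq> C" "C \<subseteq> Q"
  shows emeasure_can_ext: "A \<in> sets (hahn_ext M Q S) \<Longrightarrow>
      emeasure (can_ext M Q S \<mu>) A = emeasure \<mu> (A \<inter> \<Union>(S ` C))"
    and hahn_ext_Int_Union: "A \<in> sets (hahn_ext M Q S) \<Longrightarrow> A \<inter> \<Union>(S ` C) \<in> sets M"
    and borel_measurable_indicator_Union: "\<phi> \<in> borel_measurable (hahn_ext M Q S) \<Longrightarrow>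
      (\<lambda>x. indicator (\<Union>(S ` C)) x * \<phi> x :: real) \<in> borel_measurable M"
    and integral_can_ext: "\<phi> \<in> borel_measurable (hahn_ext M Q S) \<Longrightarrow>
      (\<integral>x. \<phi> x \<partial>can_ext M Q S \<mu>) = (\<integral>x. indicator (\<Union>(S ` C)) x * \<phi> x \<partial>\<mu>)"
proof -
  define U where "U = \<Union>(S ` C)"
  note distr = can_ext_eq_distr[OF assms, folded U_def]
  have space: "space \<mu> = space M" using \<mu> by (rule sets_eq_imp_space_eq)
  have U: "U \<in> sets M" unfolding U_def using C by (intro Union_supports)
  then have US: "U \<inter> space \<mu> \<in> sets \<mu>" "U \<subseteq> space M"
    using \<mu> sets.sets_into_space by auto
  show "emeasure (can_ext M Q S \<mu>) A = emeasure \<mu> (A \<inter> \<Union>(S ` C))" if "A \<in> sets (hahn_ext M Q S)"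
  proof -
    have "(\<lambda>x. x) -` A \<inter> space (restrict_space \<mu> U) = A \<inter> U"
      using US by (auto simp: space_restrict_space space)
    then show ?thesis
      unfolding U_def[symmetric] distr(2) using emeasure_distr[OF distr(1) that] US
      by (simp add: emeasure_restrict_space)
  qed
  show "A \<inter> \<Union>(S ` C) \<in> sets M" if A: "A \<in> sets (hahn_ext M Q S)"
  proof -
    have "A \<inter> \<Union>(S ` C) = (\<Union>q\<in>C. A \<inter> S q)" by auto
    also have "\<dots> \<in> sets M"
      using hahn_ext_Int_support[OF A] C by (intro sets.countable_UN') auto
    finally show ?thesis .
  qed
  show "(\<lambda>x. indicator (\<Union>(S ` C)) x * \<phi> x) \<in> borel_measurable M"
    if \<phi>: "\<phi> \<in> borel_measurable (hahn_ext M Q S)"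
  proof -
    have "\<phi> \<in> borel_measurable (restrict_space \<mu> U)"
      using measurable_compose[OF distr(1) \<phi>] .
    then show ?thesis
      using US \<mu> unfolding U_def[symmetric]
      by (simp add: borel_measurable_restrict_space_iff cong: measurable_cong_sets)
  qed
  show "(\<integral>x. \<phi> x \<partial>can_ext M Q S \<mu>) = (\<integral>x. indicator (\<Union>(S ` C)) x * \<phi> x \<partial>\<mu>)"
    if "\<phi> \<in> borel_measurable (hahn_ext M Q S)"
    unfolding U_def[symmetric] distr(2)
    using integral_distr[OF distr(1) that] US by (simp add: integral_restrict_space)
qed

text \<open>For a level \<open>a \<ge> 0\<close>, the set where \<phi> exceeds \<open>a\<close> is a
  union of measurable pieces of the supports, possibly uncountably many, and such unions are
  generators of the Hahn extension. Because the \<open>f q\<close> are nonnegative and \<phi> is 0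
  off the supports, a negative level gives the whole space.\<close>

lemma borel_measurable_glue:
  fixes f :: "'a measure \<Rightarrow> 'a \<Rightarrow> real"
  assumes f: "\<And>q. q \<in> Q \<Longrightarrow> f q \<in> borel_measurable M" "\<And>q x. 0 \<le> f q x"
  shows "\<exists>\<phi>\<in>borel_measurable (hahn_ext M Q S). (\<forall>q\<in>Q. \<forall>x\<in>S q. \<phi> x = f q x) \<and>
    (\<forall>x. \<phi> x = 0 \<or> (\<exists>q. \<phi> x = f q x))"
proof -
  define \<phi> where "\<phi> x = (if x \<in> \<Union>(S ` Q) then f (THE q. q \<in> Q \<and> x \<in> S q) x else 0)" for x
  have on: "\<phi> x = f q x" if "q \<in> Q" "x \<in> S q" for x q
  proof -
    have "(THE q. q \<in> Q \<and> x \<in> S q) = q"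
      using that disjoint by (intro the_equality) blast+
    then show ?thesis using that by (auto simp: \<phi>_def)
  qed
  have off: "\<phi> x = 0" if "x \<notin> \<Union>(S ` Q)" for x
    unfolding \<phi>_def using that by (rule if_not_P)
  have "\<phi> \<in> borel_measurable (hahn_ext M Q S)"
  proof (subst borel_measurable_iff_greater, intro allI)
    fix a
    show "{x \<in> space (hahn_ext M Q S). a < \<phi> x} \<in> sets (hahn_ext M Q S)"
    proof (cases "a < 0")
      case True
      then have "a < \<phi> x" for x using f(2) by (auto simp: \<phi>_def intro: less_le_trans)
      then show ?thesis by simp
    next
      case False
      have "{x \<in> space (hahn_ext M Q S). a < \<phi> x} = (\<Union>q\<in>Q. {x \<in> space M. a < f q x} \<inter> S q)"
      proof (intro subset_antisym subsetI)
        fix x assume x: "x \<in> {x \<in> space (hahn_ext M Q S). a < \<phi> x}"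
        then obtain q where "q \<in> Q" "x \<in> S q" using False off by force
        then show "x \<in> (\<Union>q\<in>Q. {x \<in> space M. a < f q x} \<inter> S q)"
          using x on by (auto simp: space_hahn_ext)
      qed (use on in \<open>auto simp: space_hahn_ext\<close>)
      then show ?thesis
        using f(1) S by (auto intro!: UN_in_hahn_ext sets.Int)
    qed
  qed
  moreover have "\<phi> x = 0 \<or> (\<exists>q. \<phi> x = f q x)" for x
    by (auto simp: \<phi>_def)
  ultimately show ?thesis using on by blast
qed

end

text \<open>In the chain from \<mu> through \<open>p\<close> to a countable mixture, a measurable
  set that is null for every component is null for \<open>p\<close> and \<mu>. Each conclusion
  reduces to that check. In the last one \<open>q\<close> need not be a component: components other
  than \<open>q\<close> do not charge \<open>S q\<close> at all. The supports of \<open>p\<close>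
  are included because the exceptional set of a test is null for the extensions of members of
  \<open>P\<close>.\<close>

lemma countably_many_supports:
  assumes PQ: "pre_hahn_localizable M P Q S"
    and H: "prob_family M H" "dominated_by H P" "\<mu> \<in> H"
  obtains p C where "p \<in> P" "countable C" "C \<subseteq> Q" "Qof Q S \<mu> \<subseteq> C" "Qof Q S p \<subseteq> C"
    "absolutely_continuous p \<mu>" "emeasure \<mu> (space M - \<Union>(S ` C)) = 0"
    "\<And>q A. q \<in> Q \<Longrightarrow> A \<in> sets M \<Longrightarrow> A \<subseteq> S q \<Longrightarrow> emeasure q A = 0 \<Longrightarrow> emeasure \<mu> A = 0"
proof -
  have S: "\<And>q. q \<in> Q \<Longrightarrow> S q \<in> sets M"
    and qS: "\<And>q r. q \<in> Q \<Longrightarrow> r \<in> Q \<Longrightarrow> emeasure q (S r) = (if q = r then 1 else 0)"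
    and Q: "\<And>q. q \<in> Q \<Longrightarrow> prob_space q" "\<And>q. q \<in> Q \<Longrightarrow> sets q = sets M"
    and P: "prob_family M P"
    using PQ by (auto simp: pre_hahn_localizable_def prob_family_def)
  obtain p where p: "p \<in> P" and ac: "absolutely_continuous p \<mu>"
    using H by (auto simp: dominated_by_def)
  obtain N where N: "N \<in> sconv M Q" and acN: "absolutely_continuous N p"
    using PQ p by (auto simp: pre_hahn_localizable_def dominated_by_def)
  obtain q :: "nat \<Rightarrow> 'a measure" and c :: "nat \<Rightarrow> real" where sN: "sets N = sets M"
    and q': "\<forall>i. q i \<in> Q"
    and em': "\<forall>A\<in>sets M. emeasure N A = (\<Sum>i. ennreal (c i) * emeasure (q i) A)"
    using N unfolding sconv_def by (elim CollectE conjE exE) (rule that)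
  note q = q'[rule_format] and em = em'[rule_format]
  have sp: "sets p = sets M" "sets \<mu> = sets M"
    using P p H by (auto simp: prob_family_def)
  have null: "emeasure p A = 0" "emeasure \<mu> A = 0" if "A \<in> sets M" "\<And>i. emeasure (q i) A = 0" for A
  proof -
    have "emeasure N A = 0" using em that by simp
    then have "A \<in> null_sets N"
      using that sN by (auto simp: null_sets_def)
    then have "A \<in> null_sets p"
      using acN by (auto simp: absolutely_continuous_def)
    then show "emeasure p A = 0" "emeasure \<mu> A = 0"
      using ac by (auto simp: absolutely_continuous_def)
  qed
  have "Qof Q S \<mu> \<subseteq> range q" "Qof Q S p \<subseteq> range q"
    using null[of "S _"] S qS q by (fastforce simp: Qof_def)+
  moreover have "emeasure \<mu> (space M - \<Union>(S ` range q)) = 0"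
  proof (rule null(2))
    show U: "space M - \<Union>(S ` range q) \<in> sets M" using S q by auto
    fix i
    interpret prob_space "q i" using Q q by blast
    have [simp]: "sets (q i) = sets M" "space (q i) = space M"
      using Q(2)[OF q] sets_eq_imp_space_eq[of "q i" M] by auto
    have "emeasure (q i) (space M - \<Union>(S ` range q)) \<le> emeasure (q i) (space M - S (q i))"
      using S q by (intro emeasure_mono) auto
    also have "\<dots> = 0"
      using emeasure_compl[of "S (q i)" "q i"] S[OF q] qS[OF q q] emeasure_space_1 by simp
    finally show "emeasure (q i) (space M - \<Union>(S ` range q)) = 0" by simp
  qed
  moreover have "emeasure \<mu> A = 0" if r: "r \<in> Q" "A \<in> sets M" "A \<subseteq> S r" "emeasure r A = 0" for r A
  proof (rule null(2))
    show "emeasure (q i) A = 0" for i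
    proof (cases "q i = r")
      case False
      then have "emeasure (q i) (S r) = 0" using qS q r by auto
      moreover have "emeasure (q i) A \<le> emeasure (q i) (S r)"
        using r S q Q by (intro emeasure_mono) auto
      ultimately show ?thesis by simp
    qed (use r in simp)
  qed fact
  ultimately show thesis
    using p ac q by (intro that[of p "range q"]) auto
qed

text \<open>Since \<open>C\<close> contains the supports charged by \<open>p\<close>, the
  exceptional set of \<phi> has a \<open>p\<close>-null trace on the supports in \<open>C\<close>,
  and absolute continuity carries this over to \<mu>. Clipping hence changes nothing \<mu>-almost
  everywhere.\<close>

lemma (in disjoint_supports) integral_can_ext_test:
  assumes \<phi>: "is_test M P Q S \<phi>" and p: "p \<in> P" "sets p = sets M"
    and \<mu>: "sets \<mu> = sets M" "absolutely_continuous p \<mu>"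
    and C: "countable C" "C \<subseteq> Q" "Qof Q S \<mu> \<subseteq> C" "Qof Q S p \<subseteq> C"
  shows "(\<integral>x. \<phi> x \<partial>can_ext M Q S \<mu>) = (\<integral>x. max 0 (min 1 (indicator (\<Union>(S ` C)) x * \<phi> x)) \<partial>\<mu>)"
proof -
  define U where "U = \<Union>(S ` C)"
  obtain N where N: "N \<in> sets (hahn_ext M Q S)" "emeasure (can_ext M Q S p) N = 0"
    and bnd: "\<And>x. x \<in> space M - N \<Longrightarrow> 0 \<le> \<phi> x \<and> \<phi> x \<le> 1"
    and \<phi>_meas: "\<phi> \<in> borel_measurable (hahn_ext M Q S)"
    using \<phi> p by (auto simp: is_test_def)
  have "N \<inter> U \<in> null_sets p"
    using N emeasure_can_ext[OF p(2) C(1,4,2)] hahn_ext_Int_Union[OF p(2) C(1,4,2)] p(2)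
    by (auto simp: null_sets_def U_def)
  then have null: "N \<inter> U \<in> null_sets \<mu>"
    using \<mu>(2) by (auto simp: absolutely_continuous_def)
  have [measurable]: "(\<lambda>x. indicator U x * \<phi> x) \<in> borel_measurable \<mu>"
    using borel_measurable_indicator_Union[OF \<mu>(1) C(1,3,2) \<phi>_meas] \<mu>(1)
    by (simp add: U_def cong: measurable_cong_sets)
  have "(\<integral>x. \<phi> x \<partial>can_ext M Q S \<mu>) = (\<integral>x. indicator U x * \<phi> x \<partial>\<mu>)"
    unfolding U_def by (rule integral_can_ext[OF \<mu>(1) C(1,3,2) \<phi>_meas])
  also have "\<dots> = (\<integral>x. max 0 (min 1 (indicator U x * \<phi> x)) \<partial>\<mu>)"
  proof (rule integral_cong_AE)
    show "AE x in \<mu>. indicator U x * \<phi> x = max 0 (min 1 (indicator U x * \<phi> x))"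
      using AE_not_in[OF null] AE_space
    proof eventually_elim
      case (elim x)
      then show ?case
        using bnd[of x] sets_eq_imp_space_eq[OF \<mu>(1)] by (auto simp: indicator_def)
    qed
  qed measurable
  finally show ?thesis by (simp add: U_def)
qed

section \<open>From a test to a lower bound on total variation\<close>

lemma convex_combination_le:
  fixes a c :: "'i \<Rightarrow> real"
  assumes "\<And>i. i \<in> I \<Longrightarrow> 0 \<le> c i" "sum c I = 1" "\<And>i. i \<in> I \<Longrightarrow> a i \<le> t"
  shows "(\<Sum>i\<in>I. c i * a i) \<le> t"
proof -
  have "(\<Sum>i\<in>I. c i * a i) \<le> (\<Sum>i\<in>I. c i * t)"
    using assms by (intro sum_mono mult_left_mono) auto
  also have "\<dots> = t" using assms(2) by (simp flip: sum_distrib_right)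
  finally show ?thesis .
qed

text \<open>The finite set \<open>F\<close> is chosen before \<open>g\<close>. This order matters,
  because the test to which the bounds are applied is itself built from the supports belonging to
  \<open>F\<close>.\<close>

lemma co_integral_bounds:
  fixes M :: "'a measure"
  assumes H: "prob_family M H" and N: "N \<in> co M H"
  obtains F where "F \<subseteq> H" "finite F"
    "\<And>g t. g \<in> borel_measurable M \<Longrightarrow> \<forall>x. 0 \<le> g x \<and> g x \<le> (1::real) \<Longrightarrow>
      \<forall>q\<in>F. (\<integral>x. g x \<partial>q) \<le> t \<Longrightarrow> (\<integral>x. g x \<partial>N) \<le> t"
    "\<And>g t. g \<in> borel_measurable M \<Longrightarrow> \<forall>x. 0 \<le> g x \<and> g x \<le> (1::real) \<Longrightarrow>
      \<forall>q\<in>F. t \<le> (\<integral>x. g x \<partial>q) \<Longrightarrow> t \<le> (\<integral>x. g x \<partial>N)"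
proof -
  obtain n and q :: "nat \<Rightarrow> 'a measure" and c :: "nat \<Rightarrow> real" where sets: "sets N = sets M"
    and q: "\<forall>i<n. q i \<in> H" and c: "\<forall>i<n. 0 \<le> c i" "(\<Sum>i<n. c i) = 1"
    and em: "\<forall>A\<in>sets M. emeasure N A = (\<Sum>i<n. ennreal (c i) * emeasure (q i) A)"
    using N unfolding co_def by (elim CollectE conjE exE) (rule that)
  have q': "prob_space (q i)" "sets (q i) = sets N" if "i < n" for i
    using q H that sets by (auto simp: prob_family_def)
  have eq: "(\<integral>x. g x \<partial>N) = (\<Sum>i<n. c i * (\<integral>x. g x \<partial>q i))"
    if "g \<in> borel_measurable M" "\<And>x. 0 \<le> g x" "\<And>x. g x \<le> (1::real)" for g
  proof (rule integral_mixture)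
    show "g \<in> borel_measurable N" using that(1) sets by (simp cong: measurable_cong_sets)
  qed (use q' c em sets that in auto)
  show thesis
  proof (rule that[of "q ` {..<n}"])
    fix g :: "'a \<Rightarrow> real" and t :: real
    assume g: "g \<in> borel_measurable M" "\<forall>x. 0 \<le> g x \<and> g x \<le> 1"
    show "(\<integral>x. g x \<partial>N) \<le> t" if "\<forall>r\<in>q ` {..<n}. (\<integral>x. g x \<partial>r) \<le> t"
      unfolding eq[OF g(1) g(2)[rule_format, THEN conjunct1] g(2)[rule_format, THEN conjunct2]]
      using c that by (intro convex_combination_le) auto
    show "t \<le> (\<integral>x. g x \<partial>N)" if "\<forall>r\<in>q ` {..<n}. t \<le> (\<integral>x. g x \<partial>r)"
      using c that convex_combination_le[of "{..<n}" c "\<lambda>i. - (\<integral>x. g x \<partial>q i)" "- t"]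
      unfolding eq[OF g(1) g(2)[rule_format, THEN conjunct1] g(2)[rule_format, THEN conjunct2]]
      by (auto simp: sum_negf)
  qed (use q in auto)
qed

lemma test_gap_le_tv_norm:
  assumes PQ: "pre_hahn_localizable M P Q S"
    and disj: "\<forall>q\<in>Q. \<forall>r\<in>Q. q \<noteq> r \<longrightarrow> S q \<inter> S r = {}"
    and H0: "prob_family M H0" "dominated_by H0 P" and H1: "prob_family M H1" "dominated_by H1 P"
    and \<phi>: "is_test M P Q S \<phi>"
    and gap: "\<And>\<mu> \<nu>. \<mu> \<in> H0 \<Longrightarrow> \<nu> \<in> H1 \<Longrightarrow>
      (\<integral>x. \<phi> x \<partial>can_ext M Q S \<mu>) + \<delta> \<le> (\<integral>x. \<phi> x \<partial>can_ext M Q S \<nu>)"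
    and \<mu>: "\<mu> \<in> co M H0" and \<nu>: "\<nu> \<in> co M H1"
  shows "\<delta> \<le> tv_norm \<mu> \<nu> / 2"
proof -
  interpret disjoint_supports M Q S
    using PQ disj by unfold_locales (auto simp: pre_hahn_localizable_def)
  define H where "H = H0 \<union> H1"
  have H: "prob_family M H" "dominated_by H P"
    using H0 H1 by (auto simp: H_def prob_family_def dominated_by_def)
  have "\<forall>\<rho>\<in>H. \<exists>C. countable C \<and> C \<subseteq> Q \<and> Qof Q S \<rho> \<subseteq> C \<and>
      (\<exists>p\<in>P. Qof Q S p \<subseteq> C \<and> absolutely_continuous p \<rho>)"
  proof
    fix \<rho> assume "\<rho> \<in> H"
    from countably_many_supports[OF PQ H this] obtain p D where "p \<in> P" "countable D" "D \<subseteq> Q"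
      "Qof Q S \<rho> \<subseteq> D" "Qof Q S p \<subseteq> D" "absolutely_continuous p \<rho>" .
    then show "\<exists>C. countable C \<and> C \<subseteq> Q \<and> Qof Q S \<rho> \<subseteq> C \<and>
        (\<exists>p\<in>P. Qof Q S p \<subseteq> C \<and> absolutely_continuous p \<rho>)"
      by blast
  qed
  then obtain C where C: "\<And>\<rho>. \<rho> \<in> H \<Longrightarrow> countable (C \<rho>)" "\<And>\<rho>. \<rho> \<in> H \<Longrightarrow> C \<rho> \<subseteq> Q"
    "\<And>\<rho>. \<rho> \<in> H \<Longrightarrow> Qof Q S \<rho> \<subseteq> C \<rho>"
    "\<And>\<rho>. \<rho> \<in> H \<Longrightarrow> \<exists>p\<in>P. Qof Q S p \<subseteq> C \<rho> \<and> absolutely_continuous p \<rho>"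
    by (metis (no_types, lifting))
  obtain F0 where F0: "F0 \<subseteq> H0" "finite F0" and co0: "\<And>g t. g \<in> borel_measurable M \<Longrightarrow>
      \<forall>x. 0 \<le> g x \<and> g x \<le> (1::real) \<Longrightarrow> \<forall>q\<in>F0. (\<integral>x. g x \<partial>q) \<le> t \<Longrightarrow> (\<integral>x. g x \<partial>\<mu>) \<le> t"
    by (rule co_integral_bounds[OF H0(1) \<mu>]) (rule that)
  obtain F1 where F1: "F1 \<subseteq> H1" "finite F1" and co1: "\<And>g t. g \<in> borel_measurable M \<Longrightarrow>
      \<forall>x. 0 \<le> g x \<and> g x \<le> (1::real) \<Longrightarrow> \<forall>q\<in>F1. t \<le> (\<integral>x. g x \<partial>q) \<Longrightarrow> t \<le> (\<integral>x. g x \<partial>\<nu>)"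
    by (rule co_integral_bounds[OF H1(1) \<nu>]) (rule that)
  define D where "D = (\<Union>\<rho>\<in>F0 \<union> F1. C \<rho>)"
  have FH: "F0 \<union> F1 \<subseteq> H" using F0 F1 by (auto simp: H_def)
  have D: "countable D" "D \<subseteq> Q"
  proof -
    have "countable (F0 \<union> F1)" using F0(2) F1(2) by (simp add: countable_finite)
    then show "countable D" unfolding D_def by (rule countable_UN) (use C(1) FH in blast)
    show "D \<subseteq> Q" unfolding D_def by (rule UN_least) (use C(2) FH in blast)
  qed
  define \<psi> where "\<psi> x = max 0 (min 1 (indicator (\<Union>(S ` D)) x * \<phi> x))" for x
  \<comment> \<open>The measurability lemma is stated for a measure whose charged supports lie in
    the given countable set. The null measure charges none and so fits every
    \<open>D\<close>.\<close>
  have "Qof Q S (null_measure M) \<subseteq> D" by (simp add: Qof_def)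
  then have "(\<lambda>x. indicator (\<Union>(S ` D)) x * \<phi> x) \<in> borel_measurable M"
    using borel_measurable_indicator_Union[of "null_measure M" D \<phi>] D \<phi> by (auto simp: is_test_def)
  then have \<psi>: "\<psi> \<in> borel_measurable M" "\<forall>x. 0 \<le> \<psi> x \<and> \<psi> x \<le> 1"
    unfolding \<psi>_def by auto
  have int: "(\<integral>x. \<psi> x \<partial>\<rho>) = (\<integral>x. \<phi> x \<partial>can_ext M Q S \<rho>)" if \<rho>: "\<rho> \<in> F0 \<union> F1" for \<rho>
  proof -
    have "\<rho> \<in> H" using \<rho> FH by auto
    then obtain p where p: "p \<in> P" "Qof Q S p \<subseteq> C \<rho>" "absolutely_continuous p \<rho>" using C(4) by blast
    have CD: "C \<rho> \<subseteq> D" using \<rho> by (auto simp: D_def)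
    have "sets p = sets M" "sets \<rho> = sets M"
      using p \<open>\<rho> \<in> H\<close> PQ H by (auto simp: pre_hahn_localizable_def prob_family_def)
    then show ?thesis
      unfolding \<psi>_def using C(3)[OF \<open>\<rho> \<in> H\<close>] p(2) CD
      by (intro integral_can_ext_test[OF \<phi> p(1) _ _ p(3) D, symmetric]) auto
  qed
  \<comment> \<open>The gap passes to the mixtures one side at a time: \<open>co1\<close> replaces
    \<open>r\<close> by \<nu> for fixed \<open>q\<close>, then \<open>co0\<close> replaces
    \<open>q\<close> by \<mu>.\<close>
  have "(\<integral>x. \<psi> x \<partial>\<mu>) \<le> (\<integral>x. \<psi> x \<partial>\<nu>) - \<delta>"
  proof (rule co0[OF \<psi>], intro ballI)
    fix q assume q: "q \<in> F0"
    have "(\<integral>x. \<psi> x \<partial>q) + \<delta> \<le> (\<integral>x. \<psi> x \<partial>\<nu>)"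
    proof (rule co1[OF \<psi>], intro ballI)
      fix r assume r: "r \<in> F1"
      show "(\<integral>x. \<psi> x \<partial>q) + \<delta> \<le> (\<integral>x. \<psi> x \<partial>r)"
        using gap[of q r] int[of q] int[of r] q r F0 F1 by auto
    qed
    then show "(\<integral>x. \<psi> x \<partial>q) \<le> (\<integral>x. \<psi> x \<partial>\<nu>) - \<delta>" by linarith
  qed
  moreover have "(\<integral>x. \<psi> x \<partial>\<nu>) - (\<integral>x. \<psi> x \<partial>\<mu>) \<le> tv_norm \<mu> \<nu> / 2"
  proof -
    note m = co_prob_space[OF H0(1) \<mu>] and n = co_prob_space[OF H1(1) \<nu>]
    have "\<psi> \<in> borel_measurable \<mu>" using \<psi>(1) m by (simp cong: measurable_cong_sets)
    then show ?thesis
      using tv_norm_attained[OF m(1) n(1)] m(2) n(2) \<psi>(2) by auto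
  qed
  ultimately show ?thesis by linarith
qed

section \<open>Construction of the test\<close>

text \<open>Finitely many constraints are met because the Hahn set of a pair of mixtures is already a good
  enough test for that pair, so the minimax lemma applies; compactness then handles all constraints
  at once.\<close>

lemma separating_test_functional:
  fixes M :: "'a measure"
  assumes H0: "prob_family M H0" and H1: "prob_family M H1"
    and tv: "\<And>\<mu> \<nu>. \<mu> \<in> co M H0 \<Longrightarrow> \<nu> \<in> co M H1 \<Longrightarrow> \<alpha> \<le> tv_norm \<mu> \<nu> / 2"
  shows "\<exists>L\<in>test_functionals M. \<forall>\<mu>\<in>H0. \<forall>\<nu>\<in>H1. L \<mu> + \<alpha> \<le> L \<nu>"
proof -
  define f :: "'a measure \<times> 'a measure \<Rightarrow> ('a measure \<Rightarrow> real) \<Rightarrow> real"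
    where "f = (\<lambda>(\<mu>, \<nu>) L. L \<nu> - L \<mu>)"
  have cont: "continuous_on UNIV (f i)" for i
    unfolding f_def by (cases i) (auto intro!: continuous_intros)
  have "test_functionals M \<inter> \<Inter>((\<lambda>i. {L. \<alpha> \<le> f i L}) ` (H0 \<times> H1)) \<noteq> {}"
  proof (rule compact_imp_fip[OF compact_test_functionals])
    show "closed T" if "T \<in> (\<lambda>i. {L. \<alpha> \<le> f i L}) ` (H0 \<times> H1)" for T
      using that cont by (auto intro!: closed_Collect_le continuous_on_const)
  next
    fix F assume "finite F" "F \<subseteq> (\<lambda>i. {L. \<alpha> \<le> f i L}) ` (H0 \<times> H1)"
    then obtain I where I: "I \<subseteq> H0 \<times> H1" "finite I" and F: "F = (\<lambda>i. {L. \<alpha> \<le> f i L}) ` I"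
      using finite_subset_image by metis
    show "test_functionals M \<inter> \<Inter>F \<noteq> {}"
    proof
      assume empty: "test_functionals M \<inter> \<Inter>F = {}"
      \<comment> \<open>Without constraints, the functional of the empty set already lies in the
        intersection.\<close>
      have "I \<noteq> {}"
        using empty set_in_test_functionals[of "{}" M] by (auto simp: F)
      moreover have "\<exists>i\<in>I. f i L < \<alpha>" if "L \<in> test_functionals M" for L
      proof (rule ccontr)
        assume "\<not> ?thesis"
        then have "L \<in> test_functionals M \<inter> \<Inter>F" using that by (auto simp: F not_less)
        then show False using empty by simp
      qed
      moreover have "\<exists>L\<in>test_functionals M. \<forall>i\<in>I. f i L = (1 - t) * f i L1 + t * f i L2"
        if "L1 \<in> test_functionals M" "L2 \<in> test_functionals M" "0 \<le> t" "t \<le> 1" for L1 L2 t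
        using convex_combination_test_functionals[OF that]
        by (rule rev_bexI) (auto simp: f_def algebra_simps)
      ultimately have "\<exists>w. (\<forall>i. 0 \<le> w i) \<and> sum w I = 1 \<and>
          (\<forall>L\<in>test_functionals M. (\<Sum>i\<in>I. w i * f i L) < \<alpha>)"
        by (intro finite_minimax I(2) compact_test_functionals cont) simp_all
      then obtain w where w: "\<And>i. 0 \<le> w i" "sum w I = 1"
        and less: "\<And>L. L \<in> test_functionals M \<Longrightarrow> (\<Sum>i\<in>I. w i * f i L) < \<alpha>"
        by blast
      \<comment> \<open>\<open>co\<close> indexes combinations by initial segments of the naturals,
        so the pairs are enumerated. Both mixtures use the weight of the pair, and a hypothesis may
        be repeated; the weighted sum of differences is then the difference of the mixtures.\<close>
      obtain h where h: "bij_betw h {0..<card I} I"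
        using ex_bij_betw_nat_finite[OF I(2)] by blast
      define n where "n = card I"
      have reindex: "(\<Sum>i\<in>I. k i) = (\<Sum>j<n. k (h j))" for k :: "_ \<Rightarrow> real"
        using sum.reindex_bij_betw[OF h, of k] by (simp add: n_def atLeast0LessThan)
      have hI: "h j \<in> I" if "j < n" for j
        using h that by (auto simp: bij_betw_def n_def)
      have fst: "prob_space (fst (h j))" "sets (fst (h j)) = sets M" "fst (h j) \<in> H0"
        and snd: "prob_space (snd (h j))" "sets (snd (h j)) = sets M" "snd (h j) \<in> H1"
        if "j < n" for j
        using hI[OF that] I H0 H1 by (auto simp: prob_family_def)
      obtain \<mu> where \<mu>: "sets \<mu> = sets M"
        "\<forall>A\<in>sets M. emeasure \<mu> A = (\<Sum>j<n. ennreal (w (h j)) * emeasure (fst (h j)) A)"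
        using mixture_exists[of n "\<lambda>j. fst (h j)" M "\<lambda>j. w (h j)"] fst by blast
      obtain \<nu> where \<nu>: "sets \<nu> = sets M"
        "\<forall>A\<in>sets M. emeasure \<nu> A = (\<Sum>j<n. ennreal (w (h j)) * emeasure (snd (h j)) A)"
        using mixture_exists[of n "\<lambda>j. snd (h j)" M "\<lambda>j. w (h j)"] snd by blast
      have "\<mu> \<in> co M H0"
        unfolding co_def using \<mu> w reindex[of w] fst
        by (intro CollectI conjI exI[of _ n] exI[of _ "\<lambda>j. fst (h j)"] exI[of _ "\<lambda>j. w (h j)"]) auto
      moreover have "\<nu> \<in> co M H1"
        unfolding co_def using \<nu> w reindex[of w] snd
        by (intro CollectI conjI exI[of _ n] exI[of _ "\<lambda>j. snd (h j)"] exI[of _ "\<lambda>j. w (h j)"]) auto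
      ultimately have "\<alpha> \<le> tv_norm \<mu> \<nu> / 2" "prob_space \<mu>" "prob_space \<nu>"
        using tv co_prob_space H0 H1 by blast+
      then obtain Y where Y: "Y \<in> sets M" "\<alpha> \<le> measure \<nu> Y - measure \<mu> Y"
        using tv_norm_attained[of \<mu> \<nu>] \<mu>(1) \<nu>(1) by auto
      define L where "L N = (if finite_measure N \<and> sets N = sets M then measure N Y else 0)" for N
      have "L \<in> test_functionals M"
        unfolding L_def by (rule set_in_test_functionals[OF Y(1)])
      have f_h: "f (h j) L = measure (snd (h j)) Y - measure (fst (h j)) Y" if "j < n" for j
      proof -
        have "finite_measure (fst (h j))" "finite_measure (snd (h j))"
          using fst(1)[OF that] snd(1)[OF that] by (auto intro: prob_space.finite_measure)
        then show ?thesis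
          using fst(2)[OF that] snd(2)[OF that] by (simp add: f_def L_def split_beta)
      qed
      have meas: "measure N Y = (\<Sum>j<n. w (h j) * measure (q j) Y)"
        if "sets N = sets M" "\<And>j. j < n \<Longrightarrow> prob_space (q j)" "\<And>j. j < n \<Longrightarrow> sets (q j) = sets M"
          "\<forall>A\<in>sets M. emeasure N A = (\<Sum>j<n. ennreal (w (h j)) * emeasure (q j) A)" for N q
      proof -
        have space: "j < n \<Longrightarrow> space (q j) = space M" "space N = space M" for j
          using sets_eq_imp_space_eq[OF that(1)] sets_eq_imp_space_eq[OF that(3)] by auto
        have "(\<integral>x. indicator Y x \<partial>N) = (\<Sum>j<n. w (h j) * (\<integral>x. indicator Y x \<partial>q j :: real))"
          using that Y(1) w(1) by (intro integral_mixture) (auto simp: indicator_def)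
        moreover have "Y \<inter> space M = Y"
          using sets.sets_into_space[OF Y(1)] by auto
        ultimately show ?thesis
          using space by simp
      qed
      have "(\<Sum>i\<in>I. w i * f i L) = (\<Sum>j<n. w (h j) * (measure (snd (h j)) Y - measure (fst (h j)) Y))"
        unfolding reindex using f_h by (intro sum.cong) auto
      also have "\<dots> = measure \<nu> Y - measure \<mu> Y"
        using meas[OF \<mu>(1) fst(1,2) \<mu>(2)] meas[OF \<nu>(1) snd(1,2) \<nu>(2)]
        by (simp add: right_diff_distrib sum_subtractf)
      finally show False
        using less[OF \<open>L \<in> test_functionals M\<close>] Y(2) by linarith
    qed
  qed
  then obtain L where L: "L \<in> test_functionals M" "\<And>i. i \<in> H0 \<times> H1 \<Longrightarrow> \<alpha> \<le> f i L"
    by auto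
  have "L \<mu> + \<alpha> \<le> L \<nu>" if "\<mu> \<in> H0" "\<nu> \<in> H1" for \<mu> \<nu>
    using L(2)[of "(\<mu>, \<nu>)"] that by (simp add: f_def)
  with L(1) show ?thesis by blast
qed

text \<open>The densities of a functional with respect to different measures are compatible, so the
  densities on the single supports determine those with respect to all dominated measures.\<close>

lemma test_functional_density_eq:
  fixes f h :: "'a \<Rightarrow> real"
  assumes \<mu>: "finite_measure \<mu>" "sets \<mu> = sets M" and q: "finite_measure q" "sets q = sets M"
    and f: "f \<in> borel_measurable M" "\<And>x. 0 \<le> f x"
      "\<And>g. g \<in> borel_measurable M \<Longrightarrow> (\<integral>\<^sup>+x. g x \<partial>\<mu>) < \<infinity> \<Longrightarrow>
        ennreal (L (density \<mu> g)) = (\<integral>\<^sup>+x. ennreal (f x) * g x \<partial>\<mu>)"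
    and h: "h \<in> borel_measurable M" "\<And>x. 0 \<le> h x"
      "\<And>g. g \<in> borel_measurable M \<Longrightarrow> (\<integral>\<^sup>+x. g x \<partial>q) < \<infinity> \<Longrightarrow>
        ennreal (L (density q g)) = (\<integral>\<^sup>+x. ennreal (h x) * g x \<partial>q)"
    and B: "B \<in> sets M" and ac: "\<And>A. A \<in> sets M \<Longrightarrow> A \<subseteq> B \<Longrightarrow> emeasure q A = 0 \<Longrightarrow> emeasure \<mu> A = 0"
  shows "AE x in \<mu>. x \<in> B \<longrightarrow> h x = f x"
proof -
  interpret \<mu>: finite_measure \<mu> by fact
  interpret q: finite_measure q by fact
  note [measurable_cong] = \<mu>(2) q(2)
  note [measurable] = f(1) h(1) B
  \<comment> \<open>\<rho> is \<mu> cut down to \<open>B\<close>, hence has a density with respect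
    to \<open>q\<close>. Each \<open>density \<rho> (indicator A)\<close> is thus a density of
    \<open>q\<close> and also of \<mu>: \<open>L\<close> has one value there, computed by
    \<open>h\<close> from one side and by \<open>f\<close> from the other. Uniqueness of densities
    then compares \<open>h\<close> with \<open>f\<close>.\<close>
  define \<rho> where "\<rho> = density \<mu> (indicator B)"
  have \<rho>: "sets \<rho> = sets M" by (simp add: \<rho>_def \<mu>)
  note [measurable_cong] = \<rho>
  have \<rho>_em: "emeasure \<rho> A = emeasure \<mu> (B \<inter> A)" if "A \<in> sets M" for A
    using that B by (simp add: \<rho>_def emeasure_restricted \<mu>(2))
  have space: "space \<mu> = space M" "space q = space M" "space \<rho> = space M"
    using \<mu>(2) q(2) \<rho> sets_eq_imp_space_eq by blast+
  interpret \<rho>: finite_measure \<rho>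
    by (rule finite_measureI) (simp add: \<rho>_em space)
  have "absolutely_continuous q \<rho>"
    unfolding absolutely_continuous_def
  proof
    fix A assume A: "A \<in> null_sets q"
    then have "A \<in> sets M" "emeasure q (B \<inter> A) = 0"
      using q(2) B emeasure_mono[of "B \<inter> A" A q] by (auto simp: null_sets_def)
    then show "A \<in> null_sets \<rho>"
      using ac[of "B \<inter> A"] B \<rho>_em by (auto simp: null_sets_def \<rho>)
  qed
  then obtain g where g: "g \<in> borel_measurable q" "density q g = \<rho>"
    using q.Radon_Nikodym_finite_measure[of \<rho>] \<rho>.finite_measure_axioms \<rho> q by auto
  then have [measurable]: "g \<in> borel_measurable M" by (simp add: q cong: measurable_cong_sets)
  have "density \<rho> (\<lambda>x. ennreal (h x)) = density \<rho> (\<lambda>x. ennreal (f x))"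
  proof (rule measure_eqI)
    fix A assume "A \<in> sets (density \<rho> (\<lambda>x. ennreal (h x)))"
    then have A[measurable]: "A \<in> sets M" by (simp add: \<rho>)
    have fin_q: "(\<integral>\<^sup>+x. g x * indicator A x \<partial>q) < \<infinity>"
    proof -
      have "(\<integral>\<^sup>+x. g x * indicator A x \<partial>q) = emeasure \<rho> A"
        unfolding g(2)[symmetric] by (simp add: emeasure_density)
      then show ?thesis by (simp add: less_top[symmetric])
    qed
    have fin_\<mu>: "(\<integral>\<^sup>+x. indicator B x * indicator A x \<partial>\<mu>) < \<infinity>"
    proof -
      have "(\<integral>\<^sup>+x. indicator B x * indicator A x \<partial>\<mu>) = emeasure \<rho> A"
        unfolding \<rho>_def by (simp add: emeasure_density)
      then show ?thesis by (simp add: less_top[symmetric])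
    qed
    have "emeasure (density \<rho> (\<lambda>x. ennreal (h x))) A = (\<integral>\<^sup>+x. ennreal (h x) * indicator A x \<partial>\<rho>)"
      by (simp add: emeasure_density)
    also have "\<dots> = (\<integral>\<^sup>+x. g x * (ennreal (h x) * indicator A x) \<partial>q)"
      unfolding g(2)[symmetric] by (rule nn_integral_density) measurable
    also have "\<dots> = (\<integral>\<^sup>+x. ennreal (h x) * (g x * indicator A x) \<partial>q)"
      by (simp add: ac_simps)
    also have "\<dots> = ennreal (L (density q (\<lambda>x. g x * indicator A x)))"
      by (rule h(3)[symmetric]) (use fin_q in auto)
    also have "density q (\<lambda>x. g x * indicator A x) = density \<rho> (indicator A)"
      unfolding g(2)[symmetric] by (rule density_density_eq[symmetric]) auto
    also have "\<dots> = density \<mu> (\<lambda>x. indicator B x * indicator A x)"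
      unfolding \<rho>_def by (rule density_density_eq) auto
    also have "ennreal (L \<dots>) = (\<integral>\<^sup>+x. ennreal (f x) * (indicator B x * indicator A x) \<partial>\<mu>)"
      by (rule f(3)) (use fin_\<mu> in auto)
    also have "\<dots> = (\<integral>\<^sup>+x. indicator B x * (ennreal (f x) * indicator A x) \<partial>\<mu>)"
      by (simp add: ac_simps)
    also have "\<dots> = (\<integral>\<^sup>+x. ennreal (f x) * indicator A x \<partial>\<rho>)"
      unfolding \<rho>_def by (rule nn_integral_density[symmetric]) measurable
    also have "\<dots> = emeasure (density \<rho> (\<lambda>x. ennreal (f x))) A"
      by (simp add: emeasure_density)
    finally show "emeasure (density \<rho> (\<lambda>x. ennreal (h x))) A = emeasure (density \<rho> (\<lambda>x. ennreal (f x))) A" .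
  qed simp
  then have "AE x in \<rho>. ennreal (h x) = ennreal (f x)"
    by (subst (asm) \<rho>.density_unique_iff) auto
  then show ?thesis
    unfolding \<rho>_def using f(2) h(2) by (subst (asm) AE_density) (auto simp: indicator_def elim!: eventually_mono)
qed

text \<open>The \<open>f q\<close> are chosen separately for each \<open>q\<close>, with no common
  version. For a fixed \<mu> its own density \<open>h\<close> is the reference: \<open>f q\<close>
  agrees with \<open>h\<close> almost everywhere on \<open>S q\<close>, and the countably many
  supports carrying \<mu> leave a countable union of null sets.\<close>

lemma test_functional_eq_test:
  assumes PQ: "pre_hahn_localizable M P Q S"
    and disj: "\<forall>q\<in>Q. \<forall>r\<in>Q. q \<noteq> r \<longrightarrow> S q \<inter> S r = {}"
    and H: "prob_family M H" "dominated_by H P"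
    and L: "L \<in> test_functionals M"
  shows "\<exists>\<phi>. is_test M P Q S \<phi> \<and> (\<forall>\<mu>\<in>H. (\<integral>x. \<phi> x \<partial>can_ext M Q S \<mu>) = L \<mu>)"
proof -
  interpret disjoint_supports M Q S
    using PQ disj by unfold_locales (auto simp: pre_hahn_localizable_def)
  define repr where "repr \<mu> f \<longleftrightarrow> f \<in> borel_measurable M \<and> (\<forall>x. 0 \<le> f x \<and> f x \<le> (1::real)) \<and>
    (\<forall>g\<in>borel_measurable M. (\<integral>\<^sup>+x. g x \<partial>\<mu>) < \<infinity> \<longrightarrow>
      ennreal (L (density \<mu> g)) = (\<integral>\<^sup>+x. ennreal (f x) * g x \<partial>\<mu>))" for \<mu> f
  have repr: "\<exists>f. repr \<mu> f" if "prob_space \<mu>" "sets \<mu> = sets M" for \<mu>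
  proof -
    interpret prob_space \<mu> by fact
    show ?thesis
      using test_functional_representation[of L] L test_functionals_cong[OF that(2)]
        measurable_cong_sets[OF that(2) refl, of "borel :: real measure"]
        measurable_cong_sets[OF that(2) refl, of "borel :: ennreal measure"]
      unfolding repr_def by auto
  qed
  have Q: "prob_space q" "sets q = sets M" if "q \<in> Q" for q
    using PQ that by (auto simp: pre_hahn_localizable_def prob_family_def)
  \<comment> \<open>The default 0 outside \<open>Q\<close> keeps the bounds valid for every index,
    as gluing demands nonnegativity for all \<open>q\<close>.\<close>
  define f where "f q = (if q \<in> Q then SOME h. repr q h else (\<lambda>_. 0))" for q
  have f: "repr q (f q)" if "q \<in> Q" for q
    using someI_ex[OF repr[OF Q[OF that]]] that by (simp add: f_def)
  have f01: "0 \<le> f q x" "f q x \<le> 1" for q x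
    using f[of q] by (cases "q \<in> Q"; auto simp: repr_def f_def)+
  obtain \<phi> where \<phi>: "\<phi> \<in> borel_measurable (hahn_ext M Q S)"
      and \<phi>_S: "\<And>q x. q \<in> Q \<Longrightarrow> x \<in> S q \<Longrightarrow> \<phi> x = f q x"
      and \<phi>_f: "\<And>x. \<phi> x = 0 \<or> (\<exists>q. \<phi> x = f q x)"
  proof -
    have "f q \<in> borel_measurable M" if "q \<in> Q" for q
      using f[OF that] by (simp add: repr_def)
    with borel_measurable_glue[of f] f01 that show thesis by auto
  qed
  have "0 \<le> \<phi> x \<and> \<phi> x \<le> 1" for x
    using \<phi>_f[of x] f01 by auto
  then have "is_test M P Q S \<phi>"
    unfolding is_test_def using \<phi> by (intro conjI bexI[of _ "{}"]) auto
  moreover have "(\<integral>x. \<phi> x \<partial>can_ext M Q S \<mu>) = L \<mu>" if \<mu>: "\<mu> \<in> H" for \<mu>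
  proof -
    have sets: "sets \<mu> = sets M" and "prob_space \<mu>" using \<mu> H by (auto simp: prob_family_def)
    interpret prob_space \<mu> by fact
    note [measurable_cong] = sets
    obtain p C where C: "countable C" "C \<subseteq> Q" "Qof Q S \<mu> \<subseteq> C"
      and full: "emeasure \<mu> (space M - \<Union>(S ` C)) = 0"
      and ac: "\<And>q A. q \<in> Q \<Longrightarrow> A \<in> sets M \<Longrightarrow> A \<subseteq> S q \<Longrightarrow> emeasure q A = 0 \<Longrightarrow> emeasure \<mu> A = 0"
      by (rule countably_many_supports[OF PQ H \<mu>]) (rule that)
    obtain h where h: "repr \<mu> h" using repr[OF \<open>prob_space \<mu>\<close> sets] by blast
    have [measurable]: "h \<in> borel_measurable M" using h by (simp add: repr_def)
    have "AE x in \<mu>. x \<in> S q \<longrightarrow> f q x = h x" if "q \<in> C" for q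
    proof -
      have q: "q \<in> Q" using that C by auto
      show ?thesis
      proof (rule test_functional_density_eq[OF _ sets _ Q(2)[OF q] _ _ _ _ _ _ S[OF q]])
        show "finite_measure \<mu>" by unfold_locales
        show "finite_measure q" using Q(1)[OF q] by (rule prob_space.finite_measure)
      qed (use h f[OF q] ac[OF q] in \<open>auto simp: repr_def\<close>)
    qed
    then have eq: "AE x in \<mu>. \<forall>q\<in>C. x \<in> S q \<longrightarrow> f q x = h x"
      using C(1) by (subst AE_ball_countable) auto
    have "space M - \<Union>(S ` C) \<in> null_sets \<mu>"
      using full Union_supports[OF C(1,2)] sets by (auto simp: null_sets_def)
    then have in_C: "AE x in \<mu>. x \<notin> space M - \<Union>(S ` C)"
      by (rule AE_not_in)
    have "(\<integral>x. \<phi> x \<partial>can_ext M Q S \<mu>) = (\<integral>x. indicator (\<Union>(S ` C)) x * \<phi> x \<partial>\<mu>)"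
      by (rule integral_can_ext[OF sets C(1,3,2) \<phi>])
    also have "\<dots> = (\<integral>x. h x \<partial>\<mu>)"
    proof (rule integral_cong_AE)
      show "(\<lambda>x. indicator (\<Union>(S ` C)) x * \<phi> x) \<in> borel_measurable \<mu>"
        using borel_measurable_indicator_Union[OF sets C(1,3,2) \<phi>] by simp
      show "AE x in \<mu>. indicator (\<Union>(S ` C)) x * \<phi> x = h x"
        using eq in_C AE_space
      proof eventually_elim
        case (elim x)
        then obtain q where q: "q \<in> C" "x \<in> S q"
          using sets_eq_imp_space_eq[OF sets] by auto
        then have "\<phi> x = h x" using elim(1) \<phi>_S[of q x] C(2) by auto
        then show ?case using q by (auto simp: indicator_def)
      qed
    qed simp
    also have "\<dots> = L \<mu>"
    proof -
      \<comment> \<open>\<mu> is its own density with the constant 1, so the representation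
        evaluates \<open>L\<close> at \<mu> itself.\<close>
      have "ennreal (L (density \<mu> (\<lambda>_. 1))) = (\<integral>\<^sup>+x. ennreal (h x) * 1 \<partial>\<mu>)"
        using h unfolding repr_def by (auto simp: emeasure_space_1)
      moreover have "integrable \<mu> h"
        using h by (intro integrable_unit_interval finite_measure_axioms) (auto simp: repr_def)
      ultimately have "ennreal (L \<mu>) = ennreal (\<integral>x. h x \<partial>\<mu>)"
        using h by (simp add: density_1 nn_integral_eq_integral repr_def)
      moreover have "0 \<le> L \<mu>" using L by (simp add: test_functionals_def)
      moreover have "0 \<le> (\<integral>x. h x \<partial>\<mu>)" using h by (simp add: repr_def)
      ultimately show ?thesis by simp
    qed
    finally show ?thesis .
  qed
  ultimately show ?thesis by blast
qed

section \<open>The equivalence: strict gaps and empty families\<close>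

theorem theorem6p5:
  fixes M :: "'a measure" and P Q H0 H1 :: "'a measure set"
    and S :: "'a measure \<Rightarrow> 'a set" and \<epsilon> :: real
  assumes "pre_hahn_localizable M P Q S"
    and "\<forall>q\<in>Q. \<forall>r\<in>Q. q \<noteq> r \<longrightarrow> S q \<inter> S r = {}"
    and "prob_family M H0" and "prob_family M H1"
    and "dominated_by H0 P" and "dominated_by H1 P"
    and "\<epsilon> > 0"
  shows "(\<exists>\<phi>. is_test M P Q S \<phi> \<and>
            (INF \<nu>\<in>H1. ereal (integral\<^sup>L (can_ext M Q S \<nu>) \<phi>))
              > (SUP \<mu>\<in>H0. ereal (integral\<^sup>L (can_ext M Q S \<mu>) \<phi>)) + ereal \<epsilon>)
         \<longleftrightarrow> d_TV (co M H0) (co M H1) > ereal \<epsilon>"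
proof
  assume "\<exists>\<phi>. is_test M P Q S \<phi> \<and>
    (INF \<nu>\<in>H1. ereal (integral\<^sup>L (can_ext M Q S \<nu>) \<phi>))
      > (SUP \<mu>\<in>H0. ereal (integral\<^sup>L (can_ext M Q S \<mu>) \<phi>)) + ereal \<epsilon>"
  then obtain \<phi> where \<phi>: "is_test M P Q S \<phi>"
    and less: "(SUP \<mu>\<in>H0. ereal (integral\<^sup>L (can_ext M Q S \<mu>) \<phi>)) + ereal \<epsilon>
      < (INF \<nu>\<in>H1. ereal (integral\<^sup>L (can_ext M Q S \<nu>) \<phi>))" (is "?a + _ < ?b")
    by blast
  \<comment> \<open>The distance is an infimum, so one \<delta> above \<epsilon> has to work for all
    pairs at once. With an empty family the condition is vacuous and \<open>\<epsilon> + 1\<close>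
    serves.\<close>
  have "\<exists>\<delta>>\<epsilon>. \<forall>\<mu>\<in>H0. \<forall>\<nu>\<in>H1. (\<integral>x. \<phi> x \<partial>can_ext M Q S \<mu>) + \<delta> \<le> (\<integral>x. \<phi> x \<partial>can_ext M Q S \<nu>)"
  proof (cases "H0 = {} \<or> H1 = {}")
    case True
    then show ?thesis by (intro exI[of _ "\<epsilon> + 1"]) auto
  next
    case False
    have a: "ereal (\<integral>x. \<phi> x \<partial>can_ext M Q S \<mu>) \<le> ?a" if "\<mu> \<in> H0" for \<mu>
      using that by (rule SUP_upper)
    have b: "?b \<le> ereal (\<integral>x. \<phi> x \<partial>can_ext M Q S \<nu>)" if "\<nu> \<in> H1" for \<nu>
      using that by (rule INF_lower)
    obtain a' where a': "?a = ereal a'"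
      using False a less by (cases ?a) force+
    obtain b' where b': "?b = ereal b'"
      using False b less by (cases ?b) force+
    show ?thesis
    proof (intro exI[of _ "b' - a'"] conjI ballI)
      show "\<epsilon> < b' - a'" using less a' b' by simp
      fix \<mu> \<nu> assume "\<mu> \<in> H0" "\<nu> \<in> H1"
      then show "(\<integral>x. \<phi> x \<partial>can_ext M Q S \<mu>) + (b' - a') \<le> (\<integral>x. \<phi> x \<partial>can_ext M Q S \<nu>)"
        using a[of \<mu>] b[of \<nu>] a' b' by simp
    qed
  qed
  then obtain \<delta> where "\<epsilon> < \<delta>" and \<delta>: "\<And>\<mu> \<nu>. \<mu> \<in> H0 \<Longrightarrow> \<nu> \<in> H1 \<Longrightarrow>
      (\<integral>x. \<phi> x \<partial>can_ext M Q S \<mu>) + \<delta> \<le> (\<integral>x. \<phi> x \<partial>can_ext M Q S \<nu>)"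
    by blast
  have "ereal \<delta> \<le> d_TV (co M H0) (co M H1)"
    unfolding d_TV_def
    using test_gap_le_tv_norm[OF assms(1,2,3,5,4,6) \<phi> \<delta>] by (intro INF_greatest) auto
  then show "ereal \<epsilon> < d_TV (co M H0) (co M H1)"
    using \<open>\<epsilon> < \<delta>\<close> by (meson ereal_less_eq(3) less_ereal.simps(1) less_le_trans)
next
  assume "ereal \<epsilon> < d_TV (co M H0) (co M H1)"
  \<comment> \<open>The distance may be infinite, as it is for an empty family, so a real number is
    inserted strictly between.\<close>
  then obtain \<alpha> where \<alpha>: "\<epsilon> < \<alpha>" "ereal \<alpha> < d_TV (co M H0) (co M H1)"
    using ereal_dense2 by (metis less_ereal.simps(1))
  have "\<alpha> \<le> tv_norm \<mu> \<nu> / 2" if "\<mu> \<in> co M H0" "\<nu> \<in> co M H1" for \<mu> \<nu>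
  proof -
    have "d_TV (co M H0) (co M H1) \<le> ereal (tv_norm (fst (\<mu>, \<nu>)) (snd (\<mu>, \<nu>)) / 2)"
      unfolding d_TV_def using that by (intro INF_lower) auto
    then have "ereal \<alpha> < ereal (tv_norm \<mu> \<nu> / 2)"
      using \<alpha>(2) by (metis fst_conv snd_conv less_le_trans)
    then show ?thesis by simp
  qed
  then obtain L where L: "L \<in> test_functionals M"
    and gap: "\<And>\<mu> \<nu>. \<mu> \<in> H0 \<Longrightarrow> \<nu> \<in> H1 \<Longrightarrow> L \<mu> + \<alpha> \<le> L \<nu>"
    using separating_test_functional[OF assms(3,4)] by metis
  have "prob_family M (H0 \<union> H1)" "dominated_by (H0 \<union> H1) P"
    using assms by (auto simp: prob_family_def dominated_by_def)
  then obtain \<phi> where \<phi>: "is_test M P Q S \<phi>"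
    and int: "\<And>\<mu>. \<mu> \<in> H0 \<union> H1 \<Longrightarrow> (\<integral>x. \<phi> x \<partial>can_ext M Q S \<mu>) = L \<mu>"
    using test_functional_eq_test[OF assms(1,2) _ _ L] by metis
  have L0: "0 \<le> L \<mu>" for \<mu> using L by (simp add: test_functionals_def)
  \<comment> \<open>Empty families need care in the extended reals: the supremum is then minus
    infinity or the infimum is plus infinity. The strict inequality follows once the other side is
    bounded, by \<open>0 \<le> L \<nu>\<close> or by \<open>L \<mu> \<le> 1\<close>.\<close>
  have "(SUP \<mu>\<in>H0. ereal (L \<mu>)) + ereal \<epsilon> < (INF \<nu>\<in>H1. ereal (L \<nu>))"
  proof (cases "H0 = {}")
    case True
    have "(0::ereal) \<le> (INF \<nu>\<in>H1. ereal (L \<nu>))"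
      using L0 by (intro INF_greatest) simp
    then show ?thesis
      using True by (auto simp: bot_ereal_def intro: less_le_trans)
  next
    case False
    show ?thesis
    proof (cases "H1 = {}")
      case True
      have "L \<mu> \<le> 1" if "\<mu> \<in> H0" for \<mu>
      proof -
        interpret prob_space \<mu> using that assms(3) by (auto simp: prob_family_def)
        have "L \<mu> \<le> measure \<mu> (space \<mu>)" using L by (simp add: test_functionals_def)
        then show ?thesis by (simp add: prob_space)
      qed
      then have "(SUP \<mu>\<in>H0. ereal (L \<mu>)) \<le> 1" by (intro SUP_least) simp
      then have "(SUP \<mu>\<in>H0. ereal (L \<mu>)) + ereal \<epsilon> \<le> 1 + ereal \<epsilon>"
        by (intro add_right_mono)
      also have "\<dots> < \<infinity>" by simp
      finally show ?thesis using True by (simp add: top_ereal_def)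
    next
      case nonempty: False
      obtain \<mu>0 \<nu>0 where 0: "\<mu>0 \<in> H0" "\<nu>0 \<in> H1" using False nonempty by blast
      have le: "(SUP \<mu>\<in>H0. ereal (L \<mu>)) \<le> ereal (L \<nu> - \<alpha>)" if "\<nu> \<in> H1" for \<nu>
        using gap that by (intro SUP_least) (auto simp: algebra_simps)
      moreover have "ereal (L \<mu>0) \<le> (SUP \<mu>\<in>H0. ereal (L \<mu>))"
        using 0 by (intro SUP_upper)
      ultimately obtain s where s: "(SUP \<mu>\<in>H0. ereal (L \<mu>)) = ereal s"
        using 0 by (cases "SUP \<mu>\<in>H0. ereal (L \<mu>)") force+
      have "s + \<alpha> \<le> L \<nu>" if "\<nu> \<in> H1" for \<nu>
        using le[OF that] s by simp
      then have "ereal (s + \<alpha>) \<le> (INF \<nu>\<in>H1. ereal (L \<nu>))"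
        by (intro INF_greatest) simp
      moreover have "ereal s + ereal \<epsilon> < ereal (s + \<alpha>)" using \<alpha>(1) by simp
      ultimately show ?thesis unfolding s by (rule less_le_trans[rotated])
    qed
  qed
  then show "\<exists>\<phi>. is_test M P Q S \<phi> \<and>
    (INF \<nu>\<in>H1. ereal (integral\<^sup>L (can_ext M Q S \<nu>) \<phi>))
      > (SUP \<mu>\<in>H0. ereal (integral\<^sup>L (can_ext M Q S \<mu>) \<phi>)) + ereal \<epsilon>"
    using \<phi> int by (intro exI[of _ \<phi>]) (simp cong: INF_cong SUP_cong)
qed

end
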